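(* Let $\gamma\ge1$, $J>0$, $a>0$ and $0\le K\ne 1$ (nonparallel case, $\sigma=\infty$). Any two rest points of the planar traveling-wave ODE with $v$-coordinates $v_i<v_j$ lying on the same side of $K$ always admit a Lax-type viscous profile connecting them, which, moreover, is monotone in both $\hat v$ and $\hat w$.
   Context: Setting: two-dimensional isentropic magnetohydrodynamics with infinite electrical resistivity ($\sigma=\infty$ in the paper's notation), in rescaled coordinates with shock speed $s=-1$ and left state $v_-=1$, $u_-=0$, $w_-=0$, $B_-$. Here $p(v)=av^{-\gamma}$ is the pressure, $p_-=p(1)=a$; constants $\mu_0>0$, $I\ge0$, $\mu>0$, $\tau=2\mu+\eta>0$, and $K=I^2/\mu_0$, $J=B_-^2/(2\mu_0)$. The planar traveling-wave ODE for $(v,w)$, $v>0$, is $$\tau v'=v(v-1)+v(p(v)-p_-)+\frac{1}{2\mu_0 v}\big((B_-+Iw)^2-v^2B_-^2\big),\qquad \mu w'=vw-\frac{I}{\mu_0}\big(B_-(1-v)+Iw\big).$$ A viscous profile connecting two rest points is a heteroclinic solution $(\hat v,\hat w)(x)$, $x\in\mathbb R$, of this system, converging to the two rest points as $x\to\pm\infty$; by the paper's convention (left-moving shocks) it runs from the rest point with larger specific volume ($x\to-\infty$) to the one with smaller specific volume ($x\to+\infty$). It is of Lax type if it connects a saddle and a node (repellor to saddle, or saddle to attractor). *)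

theory Defs
  imports "HOL-Analysis.Analysis"
begin

section \<open>Planar dynamical systems\<close>

definition rest_point :: "(real^2) set \<Rightarrow> (real^2 \<Rightarrow> real^2) \<Rightarrow> real^2 \<Rightarrow> bool" where
  "rest_point D F Z \<longleftrightarrow> Z \<in> D \<and> F Z = 0"

text \<open>Eigenvalues of a real matrix are taken over the complex numbers.\<close>

definition eigenvalue_of :: "real^2^2 \<Rightarrow> complex \<Rightarrow> bool" where
  "eigenvalue_of A l \<longleftrightarrow>
     (\<exists>z :: complex^2. z \<noteq> 0 \<and> map_matrix complex_of_real A *v z = l *s z)"

text \<open>
  The type of a rest point is that of the linearization \<open>A\<close> of the vector field there.
  For a node (repellor or attractor) all eigenvalues are real, nonzero and of one sign;
  a repeated eigenvalue is allowed. For a planar saddle there is one eigenvalue of each sign.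
\<close>

definition repelling_node :: "(real^2 \<Rightarrow> real^2) \<Rightarrow> real^2 \<Rightarrow> bool" where
  "repelling_node F Z \<longleftrightarrow> F Z = 0 \<and>
     (\<exists>A. (F has_derivative (\<lambda>h. A *v h)) (at Z) \<and>
          (\<forall>l. eigenvalue_of A l \<longrightarrow> l \<in> \<real> \<and> 0 < Re l))"

definition attracting_node :: "(real^2 \<Rightarrow> real^2) \<Rightarrow> real^2 \<Rightarrow> bool" where
  "attracting_node F Z \<longleftrightarrow> F Z = 0 \<and>
     (\<exists>A. (F has_derivative (\<lambda>h. A *v h)) (at Z) \<and>
          (\<forall>l. eigenvalue_of A l \<longrightarrow> l \<in> \<real> \<and> Re l < 0))"

definition saddle :: "(real^2 \<Rightarrow> real^2) \<Rightarrow> real^2 \<Rightarrow> bool" where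
  "saddle F Z \<longleftrightarrow> F Z = 0 \<and>
     (\<exists>A. (F has_derivative (\<lambda>h. A *v h)) (at Z) \<and>
          (\<exists>r s. r < 0 \<and> 0 < s \<and> eigenvalue_of A (complex_of_real r)
                                \<and> eigenvalue_of A (complex_of_real s)))"

definition heteroclinic ::
  "(real^2) set \<Rightarrow> (real^2 \<Rightarrow> real^2) \<Rightarrow> real^2 \<Rightarrow> real^2 \<Rightarrow> (real \<Rightarrow> real^2) \<Rightarrow> bool" where
  "heteroclinic D F Zm Zp Z \<longleftrightarrow>
     rest_point D F Zm \<and> rest_point D F Zp \<and> Zm \<noteq> Zp \<and>
     (\<forall>x. Z x \<in> D \<and> (Z has_vector_derivative F (Z x)) (at x)) \<and>
     (Z \<longlongrightarrow> Zm) at_bot \<and> (Z \<longlongrightarrow> Zp) at_top"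

definition lax_connection :: "(real^2 \<Rightarrow> real^2) \<Rightarrow> real^2 \<Rightarrow> real^2 \<Rightarrow> bool" where
  "lax_connection F Zm Zp \<longleftrightarrow>
     repelling_node F Zm \<and> saddle F Zp \<or> saddle F Zm \<and> attracting_node F Zp"


section \<open>The traveling-wave system\<close>

definition pressure :: "real \<Rightarrow> real \<Rightarrow> real \<Rightarrow> real" where
  "pressure a \<gamma> v = a * v powr (- \<gamma>)"

text \<open>
  The state is \<open>Z = (v, w)\<close>; \<open>B\<close> is the left state \<open>B\<^sub>-\<close>, and
  \<open>pressure a \<gamma> 1\<close> is \<open>p\<^sub>-\<close>, because \<open>v\<^sub>- = 1\<close>.
\<close>

definition phase_space :: "(real^2) set" where
  "phase_space = {Z. 0 < Z $ 1}"

definition tw_field ::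
  "real \<Rightarrow> real \<Rightarrow> real \<Rightarrow> real \<Rightarrow> real \<Rightarrow> real \<Rightarrow> real \<Rightarrow> real^2 \<Rightarrow> real^2" where
  "tw_field a \<gamma> \<mu>0 I B \<mu> \<tau> Z =
     (let v = Z $ 1; w = Z $ 2 in
      vector
       [(v * (v - 1) + v * (pressure a \<gamma> v - pressure a \<gamma> 1)
           + 1 / (2 * \<mu>0 * v) * ((B + I * w)\<^sup>2 - v\<^sup>2 * B\<^sup>2)) / \<tau>,
        (v * w - I / \<mu>0 * (B * (1 - v) + I * w)) / \<mu>])"

text \<open>
  The profile runs from the rest point \<open>Zm\<close> with larger specific volume to the rest point
  \<open>Zp\<close> with smaller specific volume (left-moving shocks).
\<close>

definition viscous_profile ::
  "(real^2 \<Rightarrow> real^2) \<Rightarrow> real^2 \<Rightarrow> real^2 \<Rightarrow> (real \<Rightarrow> real^2) \<Rightarrow> bool" where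
  "viscous_profile F Zm Zp Z \<longleftrightarrow> Zp $ 1 < Zm $ 1 \<and> heteroclinic phase_space F Zm Zp Z"

definition lax_viscous_profile ::
  "(real^2 \<Rightarrow> real^2) \<Rightarrow> real^2 \<Rightarrow> real^2 \<Rightarrow> (real \<Rightarrow> real^2) \<Rightarrow> bool" where
  "lax_viscous_profile F Zm Zp Z \<longleftrightarrow> viscous_profile F Zm Zp Z \<and> lax_connection F Zm Zp"

end

theory Submission
  imports Defs
begin

text \<open>
  Put \<open>B + I w = s B y\<close> with a sign \<open>s\<close> chosen so that \<open>y\<close> is positive at the rest points. The system becomes
  \<open>v' = - k(v) (A(v) - y\<^sup>2)\<close>, \<open>y' = \<sigma> n(v) (y - Y(v))\<close> with \<open>k, n > 0\<close> and \<open>\<sigma> = sgn (v - K)\<close>.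
  Here \<open>Y\<close> is the nullcline of \<open>w\<close> and \<open>y\<^sup>2 = A\<close> is that of \<open>v\<close>. The difference \<open>A - Y\<^sup>2\<close> is
  \<open>- v\<^sup>2 / J\<close> times \<open>rest_balance\<close>, the function whose zeros are the volumes of the rest points.
  On either side of \<open>K\<close> that function is strictly convex. So it is negative between \<open>v\<^sub>i\<close> and \<open>v\<^sub>j\<close>, with negative
  slope at \<open>v\<^sub>i\<close> and positive slope at \<open>v\<^sub>j\<close>: the two nullclines enclose a lens-shaped region whose tips
  are the two rest points, and inside it both components are monotone along orbits.

  At a rest point the linearization is a symmetric matrix with rescaled rows, hence has real eigenvalues, and
  its determinant has the sign of \<open>v - K\<close> times the slope of \<open>rest_balance\<close>. The sign of its entry
  \<open>(v - K) / \<mu>\<close> then separates repellors from attractors. For \<open>v > K\<close> this gives a repellor at \<open>v\<^sub>j\<close> and a saddle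
  at \<open>v\<^sub>i\<close>, for \<open>v < K\<close> a saddle at \<open>v\<^sub>j\<close> and an attractor at \<open>v\<^sub>i\<close> (\<open>rest_point_type\<close>).

  The connecting orbit is found as a graph \<open>y(v)\<close> inside the lens. Read away from the saddle tip, the equation
  for \<open>dy/dv\<close> has a right-hand side that decreases in \<open>y\<close>, so that distances between solutions shrink. Solutions
  issuing from points closer and closer to the tip start closer and closer together, because the lens closes
  there, and therefore converge to a solution on the whole open interval (\<open>solution_from_squeezed_endpoint\<close>). The slope
  \<open>dy/dv\<close> is infinite on the nullcline of \<open>v\<close>. This is avoided by an explicit barrier slightly inside the lens,
  \<open>U\<^sup>2 = (1 - \<epsilon>) A + \<epsilon> Y\<^sup>2\<close>: along it the factor \<open>A - Y\<^sup>2\<close> cancels from \<open>dy/dv\<close>, so one small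
  \<open>\<epsilon>\<close> works up to both tips (\<open>integral_curve_between_nullclines\<close>). Finally \<open>v(x)\<close> is recovered by
  integrating \<open>dx = dv / v'\<close>. As \<open>v'\<close> vanishes at least linearly at the tips, \<open>x\<close> runs through all of \<open>\<real>\<close>
  (\<open>decreasing_flow_on_interval\<close>).
\<close>

section \<open>Scalar initial value problems\<close>

text \<open>
  With the weight \<open>exp (- lam (t - a))\<close> and \<open>lam > 2 \<bar>C\<bar>\<close>, the Picard operator contracts by one half on the whole
  interval at once, however long it is. Functions are extended constantly
  outside \<open>{a..b}\<close> by the retraction \<open>r\<close> to make them elements of the complete space of bounded continuous functions.
\<close>
lemma picard_lindeloef_interval:
  fixes H :: "real \<Rightarrow> real \<Rightarrow> real"
  assumes ab: "a \<le> b"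
    and cont: "continuous_on ({a..b} \<times> UNIV) (\<lambda>(t, z). H t z)"
    and lip: "\<And>t z1 z2. t \<in> {a..b} \<Longrightarrow> \<bar>H t z1 - H t z2\<bar> \<le> C * \<bar>z1 - z2\<bar>"
  obtains y where "y a = y0"
    and "\<And>t. t \<in> {a..b} \<Longrightarrow> (y has_real_derivative H t (y t)) (at t within {a..b})"
proof -
  define lam where "lam = 2 * \<bar>C\<bar> + 1"
  define r where "r t = max a (min b t)" for t
  define h where "h z s = H s (exp (lam * (s - a)) * z s)" for z s
  define T where "T z t = exp (- lam * (r t - a)) * (y0 + integral {a..r t} (h z))" for z t
  have lam: "0 < lam" "\<bar>C\<bar> / lam \<le> 1 / 2"
    by (auto simp: lam_def divide_simps)
  have r: "r t \<in> {a..b}" for t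
    using ab by (auto simp: r_def)
  have r_id: "r t = t" if "t \<in> {a..b}" for t
    using that by (auto simp: r_def)
  have cont_r: "continuous_on UNIV r"
    unfolding r_def by (intro continuous_intros)
  have cont_H: "continuous_on {a..b} (\<lambda>s. H s (g s))" if "continuous_on {a..b} g" for g
  proof -
    have "continuous_on {a..b} (\<lambda>s. (\<lambda>(t, z). H t z) (s, g s))"
      by (rule continuous_on_compose2[OF cont]) (auto intro!: continuous_intros that)
    then show ?thesis by simp
  qed
  have cont_h: "continuous_on {a..b} (h z)" if "continuous_on UNIV z" for z
    unfolding h_def by (intro cont_H continuous_intros continuous_on_subset[OF that]) auto
  have int_h: "h z integrable_on {a..t}" if "continuous_on UNIV z" "t \<in> {a..b}" for z t
    by (rule integrable_continuous_real, rule continuous_on_subset[OF cont_h[OF that(1)]])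
      (use that in auto)
  have T_bcontfun: "T z \<in> bcontfun" if z: "continuous_on UNIV z" for z
  proof -
    define g where "g s = exp (- lam * (s - a)) * (y0 + integral {a..s} (h z))" for s
    have g: "continuous_on {a..b} g"
      unfolding g_def
      by (intro continuous_intros indefinite_integral_continuous_1 int_h z) (use ab in auto)
    have Tg: "T z = (\<lambda>t. g (r t))"
      by (auto simp: T_def g_def)
    have "continuous_on UNIV (T z)"
      unfolding Tg by (rule continuous_on_compose2[OF g cont_r]) (use r in auto)
    moreover have "bounded (g ` {a..b})"
      by (intro compact_imp_bounded compact_continuous_image g) auto
    then have "bounded (range (T z))"
      unfolding Tg by (rule bounded_subset) (use r in auto)
    ultimately show ?thesis by (simp add: bcontfun_def)
  qed
  define P :: "(real \<Rightarrow>\<^sub>C real) \<Rightarrow> (real \<Rightarrow>\<^sub>C real)" where "P z = Bcontfun (T z)" for z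
  have P: "apply_bcontfun (P z) = T z" for z
    unfolding P_def by (rule Bcontfun_inverse) (rule T_bcontfun, simp)
  have "dist (P z1) (P z2) \<le> 1 / 2 * dist z1 z2" for z1 z2
  proof (rule dist_bound)
    fix t
    let ?d = "dist z1 z2" and ?e = "\<lambda>s. exp (lam * (s - a))"
    have c: "continuous_on UNIV (apply_bcontfun z1)" "continuous_on UNIV (apply_bcontfun z2)"
      by auto
    have bound: "norm (h z1 s - h z2 s) \<le> \<bar>C\<bar> * ?d * ?e s" if "s \<in> {a..r t}" for s
    proof -
      have s: "s \<in> {a..b}" using that r[of t] by auto
      have "\<bar>h z1 s - h z2 s\<bar> \<le> C * \<bar>?e s * z1 s - ?e s * z2 s\<bar>"
        unfolding h_def by (rule lip[OF s])
      also have "\<dots> \<le> \<bar>C\<bar> * \<bar>?e s * z1 s - ?e s * z2 s\<bar>"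
        by (rule mult_right_mono) auto
      also have "\<bar>?e s * z1 s - ?e s * z2 s\<bar> = ?e s * dist (z1 s) (z2 s)"
        by (simp add: dist_real_def abs_mult flip: right_diff_distrib)
      also have "\<bar>C\<bar> * \<dots> \<le> \<bar>C\<bar> * (?e s * ?d)"
        by (intro mult_left_mono dist_bounded) auto
      finally show ?thesis by (simp add: mult_ac)
    qed
    have e_int: "(?e has_integral (?e (r t) / lam - ?e a / lam)) {a..r t}"
      using lam(1) r[of t] by (intro fundamental_theorem_of_calculus)
        (auto intro!: derivative_eq_intros simp flip: has_real_derivative_iff_has_vector_derivative)
    have "norm (integral {a..r t} (\<lambda>s. h z1 s - h z2 s)) \<le> integral {a..r t} (\<lambda>s. \<bar>C\<bar> * ?d * ?e s)"
      by (rule integral_norm_bound_integral)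
        (use bound r c e_int in \<open>auto intro!: integrable_diff int_h has_integral_integrable[OF has_integral_mult_right[OF e_int]]\<close>)
    also have "\<dots> = \<bar>C\<bar> * ?d * (?e (r t) / lam - ?e a / lam)"
      using has_integral_mult_right[OF e_int] by (rule integral_unique)
    also have "\<dots> \<le> \<bar>C\<bar> * ?d * (?e (r t) / lam)"
      using lam(1) by (intro mult_left_mono) auto
    also have "\<dots> = \<bar>C\<bar> / lam * (?d * ?e (r t))"
      by simp
    also have "\<dots> \<le> 1 / 2 * (?d * ?e (r t))"
      using lam(2) by (rule mult_right_mono) auto
    finally have *: "norm (integral {a..r t} (\<lambda>s. h z1 s - h z2 s)) \<le> 1 / 2 * ?d * ?e (r t)"
      by simp
    have "T z1 t - T z2 t = exp (- lam * (r t - a)) * integral {a..r t} (\<lambda>s. h z1 s - h z2 s)"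
      by (subst integral_diff) (use r c in \<open>auto intro!: int_h simp: T_def algebra_simps\<close>)
    then have "dist (T z1 t) (T z2 t) = exp (- lam * (r t - a)) * norm (integral {a..r t} (\<lambda>s. h z1 s - h z2 s))"
      by (simp add: dist_real_def abs_mult)
    also have "\<dots> \<le> exp (- lam * (r t - a)) * (1 / 2 * ?d * ?e (r t))"
      by (intro mult_left_mono *) auto
    also have "\<dots> = 1 / 2 * ?d"
      by (simp add: exp_minus field_simps flip: exp_add)
    finally show "dist (P z1 t) (P z2 t) \<le> 1 / 2 * ?d"
      by (simp add: P)
  qed
  then obtain z where z: "P z = z"
    using banach_fix_type[of "1 / 2" P] by auto
  define y where "y t = exp (lam * (t - a)) * z t" for t
  have hz: "h z = (\<lambda>s. H s (y s))"
    by (auto simp: h_def y_def)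
  have y: "y t = y0 + integral {a..t} (h z)" if "t \<in> {a..b}" for t
  proof -
    have "y t = exp (lam * (t - a)) * T z t"
      by (simp add: y_def z flip: P)
    also have "\<dots> = y0 + integral {a..t} (h z)"
      by (simp add: T_def r_id[OF that] flip: exp_add mult.assoc)
    finally show ?thesis .
  qed
  show thesis
  proof
    show "y a = y0" using y[of a] ab by simp
    fix t assume t: "t \<in> {a..b}"
    have "((\<lambda>t. y0 + integral {a..t} (h z)) has_real_derivative h z t) (at t within {a..b})"
      using integral_has_real_derivative[OF cont_h t, of z] by (auto intro!: derivative_eq_intros)
    then have "(y has_real_derivative h z t) (at t within {a..b})"
      by (rule has_field_derivative_transform_within[of _ _ _ _ 1]) (use t y in auto)
    then show "(y has_real_derivative H t (y t)) (at t within {a..b})"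
      by (simp add: hz)
  qed
qed

text \<open>
  The non-strict barrier principle: it suffices that \<open>w\<close> cannot increase where it is positive. It is applied
  to differences of a solution and a barrier and to differences of two solutions.
\<close>
lemma nonpos_barrier:
  fixes w w' :: "real \<Rightarrow> real"
  assumes der: "\<And>t. t \<in> {a..b} \<Longrightarrow> (w has_real_derivative w' t) (at t within {a..b})"
    and init: "w a \<le> 0"
    and sink: "\<And>t. t \<in> {a..b} \<Longrightarrow> 0 < w t \<Longrightarrow> w' t \<le> 0"
    and t: "t \<in> {a..b}"
  shows "w t \<le> 0"
proof (rule ccontr)
  assume "\<not> w t \<le> 0"
  have cont: "continuous_on {a..b} w"
    using der by (meson DERIV_continuous continuous_on_eq_continuous_within)
  \<comment> \<open>After the maximum of \<open>E\<close> the function \<open>w\<close> is positive up to \<open>t\<close>, hence cannot increase.\<close>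
  define E where "E = {s \<in> {a..t}. w s \<le> 0}"
  have "closed E" unfolding E_def
    by (intro continuous_on_closed_Collect_le
        continuous_intros continuous_on_subset[OF cont])
      (use t in auto)
  moreover have "a \<in> E" using init t by (auto simp: E_def)
  moreover have "bounded E" by (rule bounded_subset[of "{a..t}"]) (auto simp: E_def)
  ultimately obtain s where s: "s \<in> E" "\<And>r. r \<in> E \<Longrightarrow> r \<le> s"
    by (metis compact_attains_sup compact_eq_bounded_closed empty_iff)
  have st: "s < t" "w s \<le> 0" "a \<le> s" using s \<open>\<not> w t \<le> 0\<close> by (auto simp: E_def order_le_less)
  have "w t \<le> w s"
  proof (rule DERIV_nonpos_imp_decreasing_open[of s t w])
    show "s \<le> t" using st by simp
    show "continuous_on {s..t} w" by (rule continuous_on_subset[OF cont]) (use st t in auto)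
    fix r assume r: "s < r" "r < t"
    then have rab: "r \<in> {a<..<b}" using st t by auto
    have "(w has_real_derivative w' r) (at r)"
      using der[of r] rab at_within_interior[of r "{a..b}"] by (auto simp: at_within_Icc_at)
    moreover have "0 < w r" using s(2)[of r] r st by (force simp: E_def)
    then have "w' r \<le> 0" using sink[of r] rab by auto
    ultimately show "\<exists>d. (w has_real_derivative d) (at r) \<and> d \<le> 0" by blast
  qed
  then show False using st \<open>\<not> w t \<le> 0\<close> by simp
qed

text \<open>
  No initial condition is available at the left end \<open>\<alpha>\<close>, where \<open>H\<close> may be singular; the lower and upper
  barriers meeting there replace it. The solutions \<open>Y n\<close> start on the lower barrier at points \<open>A n\<close> tending to
  \<open>\<alpha>\<close> and stay between the barriers. Since \<open>H\<close> decreases in the state, later solutions stay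
  within the initial gap \<open>u (A n) - l (A n)\<close> of \<open>Y n\<close>, so they converge locally uniformly.
\<close>
lemma solution_from_squeezed_endpoint:
  fixes H :: "real \<Rightarrow> real \<Rightarrow> real" and l u L :: "real \<Rightarrow> real"
  assumes \<alpha>\<beta>: "\<alpha> < \<beta>"
    and cont: "continuous_on ({\<alpha><..<\<beta>} \<times> UNIV) (\<lambda>(t, z). H t z)"
    and L: "continuous_on {\<alpha><..<\<beta>} L"
    and lip: "\<And>t z1 z2. t \<in> {\<alpha><..<\<beta>} \<Longrightarrow> \<bar>H t z1 - H t z2\<bar> \<le> L t * \<bar>z1 - z2\<bar>"
    and decr: "\<And>t z1 z2. t \<in> {\<alpha><..<\<beta>} \<Longrightarrow> z1 \<le> z2 \<Longrightarrow> H t z2 \<le> H t z1"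
    and l: "\<And>t. t \<in> {\<alpha><..<\<beta>} \<Longrightarrow> (l has_real_derivative l' t) (at t)"
    and u: "\<And>t. t \<in> {\<alpha><..<\<beta>} \<Longrightarrow> (u has_real_derivative u' t) (at t)"
    and lu: "\<And>t. t \<in> {\<alpha><..<\<beta>} \<Longrightarrow> l t \<le> u t"
    and lower: "\<And>t. t \<in> {\<alpha><..<\<beta>} \<Longrightarrow> l' t \<le> H t (l t)"
    and upper: "\<And>t. t \<in> {\<alpha><..<\<beta>} \<Longrightarrow> H t (u t) \<le> u' t"
    and squeeze: "((\<lambda>t. u t - l t) \<longlongrightarrow> 0) (at_right \<alpha>)"
  obtains y where "\<And>t. t \<in> {\<alpha><..<\<beta>} \<Longrightarrow> l t \<le> y t \<and> y t \<le> u t"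
    and "\<And>t. t \<in> {\<alpha><..<\<beta>} \<Longrightarrow> (y has_real_derivative H t (y t)) (at t)"
proof -
  define A where "A n = \<alpha> + (\<beta> - \<alpha>) / 3 * inverse (real (Suc n))" for n
  define B where "B n = \<beta> - (\<beta> - \<alpha>) / 3 * inverse (real (Suc n))" for n
  have AB: "\<alpha> < A n" "A n < B n" "B n < \<beta>" for n
  proof -
    define e where "e = (\<beta> - \<alpha>) / 3 * inverse (real (Suc n))"
    have "0 < e"
      using \<alpha>\<beta> by (simp add: e_def)
    moreover have "e \<le> (\<beta> - \<alpha>) / 3 * 1"
      unfolding e_def using \<alpha>\<beta> by (intro mult_left_mono) (auto simp: divide_simps)
    moreover have "A n = \<alpha> + e" "B n = \<beta> - e"
      by (simp_all add: A_def B_def e_def)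
    ultimately show "\<alpha> < A n" "A n < B n" "B n < \<beta>"
      using \<alpha>\<beta> by simp_all
  qed
  have AB_mono: "A m \<le> A n" "B n \<le> B m" if "n \<le> m" for m n
    using \<alpha>\<beta> that unfolding A_def B_def
    by (auto intro!: add_left_mono diff_left_mono mult_left_mono le_imp_inverse_le)
  have sub: "{A n..B n} \<subseteq> {\<alpha><..<\<beta>}" for n
    using AB[of n] by auto
  have A_lim: "A \<longlonglongrightarrow> \<alpha>"
    using tendsto_add[OF tendsto_const tendsto_mult[OF tendsto_const LIMSEQ_inverse_real_of_nat],
        of \<alpha> "(\<beta> - \<alpha>) / 3"]
    by (simp add: A_def[abs_def] del: of_nat_Suc)
  have B_lim: "B \<longlonglongrightarrow> \<beta>"
    using tendsto_diff[OF tendsto_const tendsto_mult[OF tendsto_const LIMSEQ_inverse_real_of_nat],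
        of \<beta> "(\<beta> - \<alpha>) / 3"]
    by (simp add: B_def[abs_def] del: of_nat_Suc)
  have L_bound: "\<exists>C. \<forall>t\<in>{A n..B n}. L t \<le> C" for n
  proof -
    have "compact (L ` {A n..B n})"
      by (rule compact_continuous_image[OF continuous_on_subset[OF L sub]]) simp
    then have "bdd_above (L ` {A n..B n})"
      by (simp add: bounded_imp_bdd_above compact_imp_bounded)
    then show ?thesis by (auto simp: bdd_above_def)
  qed
  have within: "(f has_real_derivative D) (at t within {a..b})" if "(f has_real_derivative D) (at t)" for f D t a b
    using that by (rule has_field_derivative_at_within)

  have "\<exists>y. y (A n) = l (A n) \<and>
      (\<forall>t\<in>{A n..B n}. (y has_real_derivative H t (y t)) (at t within {A n..B n}))" for n
  proof -
    obtain C where C: "\<forall>t\<in>{A n..B n}. L t \<le> C" using L_bound by blast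
    have "\<bar>H t z1 - H t z2\<bar> \<le> C * \<bar>z1 - z2\<bar>" if "t \<in> {A n..B n}" for t z1 z2
    proof -
      have "\<bar>H t z1 - H t z2\<bar> \<le> L t * \<bar>z1 - z2\<bar>" using lip that sub by blast
      also have "\<dots> \<le> C * \<bar>z1 - z2\<bar>" using C that by (intro mult_right_mono) auto
      finally show ?thesis .
    qed
    moreover have "continuous_on ({A n..B n} \<times> UNIV) (\<lambda>(t, z). H t z)"
      by (rule continuous_on_subset[OF cont]) (use sub in blast)
    ultimately show ?thesis
      using picard_lindeloef_interval[of "A n" "B n" H C "l (A n)"] AB(2)[of n] by (metis less_imp_le)
  qed
  then obtain Y where Y0: "\<And>n. Y n (A n) = l (A n)"
    and Y: "\<And>n t. t \<in> {A n..B n} \<Longrightarrow> (Y n has_real_derivative H t (Y n t)) (at t within {A n..B n})"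
    by metis
  have Y_l: "l t \<le> Y n t" if t: "t \<in> {A n..B n}" for n t
  proof -
    have "l t - Y n t \<le> 0"
    proof (rule nonpos_barrier[of "A n" "B n" "\<lambda>t. l t - Y n t" "\<lambda>t. l' t - H t (Y n t)"])
      show "((\<lambda>t. l t - Y n t) has_real_derivative l' s - H s (Y n s)) (at s within {A n..B n})"
        if "s \<in> {A n..B n}" for s
        by (intro DERIV_diff Y that within l) (use that sub in blast)
      show "l' s - H s (Y n s) \<le> 0" if "s \<in> {A n..B n}" "0 < l s - Y n s" for s
      proof -
        have "s \<in> {\<alpha><..<\<beta>}" using that sub by blast
        then show ?thesis using lower[of s] decr[of s "Y n s" "l s"] that by auto
      qed
    qed (use t Y0 in auto)
    then show ?thesis by simp
  qed
  have Y_u: "Y n t \<le> u t" if t: "t \<in> {A n..B n}" for n t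
  proof -
    have "Y n t - u t \<le> 0"
    proof (rule nonpos_barrier[of "A n" "B n" "\<lambda>t. Y n t - u t" "\<lambda>t. H t (Y n t) - u' t"])
      show "((\<lambda>t. Y n t - u t) has_real_derivative H s (Y n s) - u' s) (at s within {A n..B n})"
        if "s \<in> {A n..B n}" for s
        by (intro DERIV_diff Y that within u) (use that sub in blast)
      show "H s (Y n s) - u' s \<le> 0" if "s \<in> {A n..B n}" "0 < Y n s - u s" for s
      proof -
        have "s \<in> {\<alpha><..<\<beta>}" using that sub by blast
        then show ?thesis using upper[of s] decr[of s "u s" "Y n s"] that by auto
      qed
      have "A n \<in> {\<alpha><..<\<beta>}" using AB[of n] by auto
      then show "Y n (A n) - u (A n) \<le> 0" using lu Y0 by auto
    qed (use t in auto)
    then show ?thesis by simp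
  qed

  define d where "d n = u (A n) - l (A n)" for n
  have d_lim: "d \<longlonglongrightarrow> 0"
    unfolding d_def
    by (rule filterlim_compose[OF squeeze])
      (use A_lim AB in \<open>auto simp: filterlim_at intro!: always_eventually\<close>)
  have contract: "\<bar>Y m t - Y n t\<bar> \<le> d n" if nm: "n \<le> m" and t: "t \<in> {A n..B n}" for m n t
  proof -
    have sub': "{A n..B n} \<subseteq> {A m..B m}" using AB_mono[OF nm] by auto
    have Ym: "(Y m has_real_derivative H s (Y m s)) (at s within {A n..B n})" if "s \<in> {A n..B n}" for s
      using DERIV_subset[OF Y sub'] that sub' by blast
    have An: "A n \<in> {A n..B n}" using AB(2)[of n] by simp
    then have An': "A n \<in> {A m..B m}" using sub' by blast
    have init: "\<bar>Y m (A n) - Y n (A n)\<bar> \<le> d n"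
      using Y_l[OF An'] Y_u[OF An'] Y0[of n] by (auto simp: d_def)
    have "Y m t - Y n t - d n \<le> 0"
    proof (rule nonpos_barrier[of "A n" "B n" "\<lambda>t. Y m t - Y n t - d n" "\<lambda>t. H t (Y m t) - H t (Y n t)"])
      show "((\<lambda>t. Y m t - Y n t - d n) has_real_derivative H s (Y m s) - H s (Y n s)) (at s within {A n..B n})"
        if "s \<in> {A n..B n}" for s
        using DERIV_diff[OF DERIV_diff[OF Ym[OF that] Y[OF that]] DERIV_const[of "d n"]] by simp
      show "H s (Y m s) - H s (Y n s) \<le> 0" if "s \<in> {A n..B n}" "0 < Y m s - Y n s - d n" for s
      proof -
        have "s \<in> {\<alpha><..<\<beta>}" using that sub by blast
        then show ?thesis using decr[of s "Y n s" "Y m s"] that init by auto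
      qed
    qed (use t init in auto)
    moreover have "Y n t - Y m t - d n \<le> 0"
    proof (rule nonpos_barrier[of "A n" "B n" "\<lambda>t. Y n t - Y m t - d n" "\<lambda>t. H t (Y n t) - H t (Y m t)"])
      show "((\<lambda>t. Y n t - Y m t - d n) has_real_derivative H s (Y n s) - H s (Y m s)) (at s within {A n..B n})"
        if "s \<in> {A n..B n}" for s
        using DERIV_diff[OF DERIV_diff[OF Y[OF that] Ym[OF that]] DERIV_const[of "d n"]] by simp
      show "H s (Y n s) - H s (Y m s) \<le> 0" if "s \<in> {A n..B n}" "0 < Y n s - Y m s - d n" for s
      proof -
        have "s \<in> {\<alpha><..<\<beta>}" using that sub by blast
        then show ?thesis using decr[of s "Y m s" "Y n s"] that init by auto
      qed
    qed (use t init in auto)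
    ultimately show ?thesis by linarith
  qed
  have inside: "\<exists>N. A N < t \<and> t < B N" if "t \<in> {\<alpha><..<\<beta>}" for t
  proof -
    have "\<forall>\<^sub>F n in sequentially. A n < t" "\<forall>\<^sub>F n in sequentially. t < B n"
      using that A_lim B_lim by (auto intro: order_tendstoD)
    then have "\<forall>\<^sub>F n in sequentially. A n < t \<and> t < B n" by eventually_elim simp
    then show ?thesis by (auto simp: eventually_sequentially)
  qed
  define y where "y t = lim (\<lambda>n. Y n t)" for t
  have y: "(\<lambda>n. Y n t) \<longlonglongrightarrow> y t" if "t \<in> {A N..B N}" for t N
  proof -
    have "Cauchy (\<lambda>n. Y n t)"
    proof (rule metric_CauchyI)
      fix e :: real assume "0 < e"
      then have "\<forall>\<^sub>F n in sequentially. d n < e / 2"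
        using order_tendstoD(2)[OF d_lim, of "e / 2"] by simp
      then obtain M where M: "d (max M N) < e / 2"
        unfolding eventually_sequentially by (meson max.cobounded1)
      let ?M = "max M N"
      have t: "t \<in> {A ?M..B ?M}" using that AB_mono[of N ?M] by auto
      have "dist (Y m t) (Y n t) < e" if "?M \<le> m" "?M \<le> n" for m n
        using contract[OF that(1) t] contract[OF that(2) t] M by (auto simp: dist_real_def)
      then show "\<exists>M. \<forall>m\<ge>M. \<forall>n\<ge>M. dist (Y m t) (Y n t) < e" by blast
    qed
    then show ?thesis unfolding y_def by (simp add: Cauchy_convergent_iff convergent_LIMSEQ_iff)
  qed
  have y_close: "\<bar>Y n t - y t\<bar> \<le> d n" if t: "t \<in> {A n..B n}" for n t
  proof -
    have "(\<lambda>m. \<bar>Y m t - Y n t\<bar>) \<longlonglongrightarrow> \<bar>y t - Y n t\<bar>"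
      by (intro tendsto_intros y[OF t])
    then have "\<bar>y t - Y n t\<bar> \<le> d n"
      by (rule LIMSEQ_le_const2) (use contract t in blast)
    then show ?thesis by (simp add: abs_minus_commute)
  qed
  show thesis
  proof
    fix t assume t: "t \<in> {\<alpha><..<\<beta>}"
    then obtain N where N: "A N < t" "t < B N" using inside by blast
    let ?S = "{A N..B N}"
    have tS: "t \<in> ?S" using N by auto
    have sub_S: "{A N..B N} \<subseteq> {A (n + N)..B (n + N)}" for n using AB_mono[of N "n + N"] by auto
    have "l t \<le> y t"
      by (rule LIMSEQ_le_const[OF LIMSEQ_ignore_initial_segment[OF y[OF tS], of N]])
        (use Y_l sub_S tS in blast)
    moreover have "y t \<le> u t"
      by (rule LIMSEQ_le_const2[OF LIMSEQ_ignore_initial_segment[OF y[OF tS], of N]])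
        (use Y_u sub_S tS in blast)
    ultimately show "l t \<le> y t \<and> y t \<le> u t" ..
    obtain C where C: "\<forall>t\<in>?S. L t \<le> C" using L_bound by blast
    have "\<exists>g. \<forall>x\<in>?S. (\<lambda>n. Y (n + N) x) \<longlonglongrightarrow> g x \<and>
        (g has_derivative (\<lambda>h. H x (y x) * h)) (at x within ?S)"
    proof (rule has_derivative_sequence)
      show "(Y (n + N) has_derivative (\<lambda>h. H x (Y (n + N) x) * h)) (at x within ?S)" if "x \<in> ?S" for n x
        using DERIV_subset[OF Y sub_S] that sub_S
        unfolding has_field_derivative_def by blast
      show "(\<lambda>n. Y (n + N) t) \<longlonglongrightarrow> y t" by (rule LIMSEQ_ignore_initial_segment[OF y[OF tS]])
      fix e :: real assume "0 < e"
      have "(\<lambda>n. \<bar>C\<bar> * d (n + N)) \<longlonglongrightarrow> \<bar>C\<bar> * 0"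
        by (intro tendsto_intros LIMSEQ_ignore_initial_segment d_lim)
      then have "\<forall>\<^sub>F n in sequentially. \<bar>C\<bar> * d (n + N) < e"
        using order_tendstoD(2)[of _ "\<bar>C\<bar> * 0" sequentially e] \<open>0 < e\<close> by simp
      then show "\<forall>\<^sub>F n in sequentially. \<forall>x\<in>?S. \<forall>h. norm (H x (Y (n + N) x) * h - H x (y x) * h) \<le> e * norm h"
      proof eventually_elim
        case (elim n)
        show ?case
        proof (intro ballI allI)
          fix x h assume x: "x \<in> ?S"
          have x': "x \<in> {A (n + N)..B (n + N)}" using x sub_S by blast
          have "\<bar>H x (Y (n + N) x) - H x (y x)\<bar> \<le> L x * \<bar>Y (n + N) x - y x\<bar>"
            using lip x sub by blast
          also have "\<dots> \<le> \<bar>C\<bar> * \<bar>Y (n + N) x - y x\<bar>"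
            using C x by (intro mult_right_mono) force+
          also have "\<dots> \<le> \<bar>C\<bar> * d (n + N)"
            by (intro mult_left_mono y_close x') auto
          finally have "\<bar>H x (Y (n + N) x) - H x (y x)\<bar> \<le> e" using elim by simp
          then show "norm (H x (Y (n + N) x) * h - H x (y x) * h) \<le> e * norm h"
            by (simp add: abs_mult mult_right_mono flip: left_diff_distrib)
        qed
      qed
    qed (use tS in auto)
    then obtain g where g: "\<And>x. x \<in> ?S \<Longrightarrow> (\<lambda>n. Y (n + N) x) \<longlonglongrightarrow> g x"
      "\<And>x. x \<in> ?S \<Longrightarrow> (g has_real_derivative H x (y x)) (at x within ?S)"
      unfolding has_field_derivative_def by blast
    have "g x = y x" if "x \<in> ?S" for x
      using g(1)[OF that] LIMSEQ_ignore_initial_segment[OF y[OF that], of N] by (rule LIMSEQ_unique)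
    then have "(y has_real_derivative H t (y t)) (at t within ?S)"
      using g(2)[OF tS] tS by (auto intro: has_field_derivative_transform_within[of _ _ _ _ 1])
    then show "(y has_real_derivative H t (y t)) (at t)"
      using N by (simp add: at_within_Icc_at)
  qed
qed

section \<open>Integral curves between two nullclines\<close>

text \<open>
  The curve \<open>y = U\<close> with \<open>U\<^sup>2 = (1 - \<epsilon>) A + \<epsilon> Y\<^sup>2\<close> satisfies \<open>A - U\<^sup>2 = \<epsilon> (A - Y\<^sup>2)\<close> and
  \<open>U - Y = (1 - \<epsilon>) (A - Y\<^sup>2) / (U + Y)\<close>. On it the right-hand side is therefore
  \<open>- m (1 - \<epsilon>) / (\<epsilon> (U + Y))\<close>, which for small \<open>\<epsilon>\<close> lies below \<open>U'\<close> uniformly on the closed interval. Cutting the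
  right-hand side off outside \<open>[Y, U]\<close> makes it Lipschitz in \<open>y\<close>, locally uniformly in \<open>v\<close>, and the
  solution never sees the cut-off.
\<close>
lemma integral_curve_between_nullclines:
  fixes A A' Y Y' m :: "real \<Rightarrow> real"
  assumes \<alpha>\<beta>: "\<alpha> < \<beta>"
    and A: "\<And>v. v \<in> {\<alpha>..\<beta>} \<Longrightarrow> (A has_real_derivative A' v) (at v)"
    and Y: "\<And>v. v \<in> {\<alpha>..\<beta>} \<Longrightarrow> (Y has_real_derivative Y' v) (at v)"
    and A': "continuous_on {\<alpha>..\<beta>} A'" and Y': "continuous_on {\<alpha>..\<beta>} Y'"
    and m: "continuous_on {\<alpha>..\<beta>} m"
    and m_pos: "\<And>v. v \<in> {\<alpha>..\<beta>} \<Longrightarrow> 0 < m v"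
    and Y_pos: "\<And>v. v \<in> {\<alpha>..\<beta>} \<Longrightarrow> 0 < Y v"
    and Y_decr: "\<And>v. v \<in> {\<alpha>..\<beta>} \<Longrightarrow> Y' v \<le> 0"
    and gap: "\<And>v. v \<in> {\<alpha><..<\<beta>} \<Longrightarrow> (Y v)\<^sup>2 < A v"
    and meet: "A \<alpha> = (Y \<alpha>)\<^sup>2"
  obtains y where "\<And>v. v \<in> {\<alpha><..<\<beta>} \<Longrightarrow> Y v \<le> y v \<and> (y v)\<^sup>2 < A v"
    and "\<And>v. v \<in> {\<alpha><..<\<beta>} \<Longrightarrow>
           (y has_real_derivative - (m v * (y v - Y v) / (A v - (y v)\<^sup>2))) (at v)"
proof -
  have cA: "continuous_on {\<alpha>..\<beta>} A" and cY: "continuous_on {\<alpha>..\<beta>} Y"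
    using A Y by (meson DERIV_isCont continuous_at_imp_continuous_on)+
  have bdd: "\<exists>C>0. \<forall>v\<in>{\<alpha>..\<beta>}. \<bar>f v\<bar> \<le> C" if "continuous_on {\<alpha>..\<beta>} f" for f :: "real \<Rightarrow> real"
    using compact_imp_bounded[OF compact_continuous_image[OF that compact_Icc]]
    by (auto simp: bounded_pos)
  obtain M1 where M1: "0 < M1" "\<And>v. v \<in> {\<alpha>..\<beta>} \<Longrightarrow> \<bar>A' v\<bar> \<le> M1" using bdd[OF A'] by blast
  have "continuous_on {\<alpha>..\<beta>} (\<lambda>v. 2 * Y v * Y' v)" by (intro continuous_intros cY Y')
  then obtain M2 where M2: "0 < M2" "\<And>v. v \<in> {\<alpha>..\<beta>} \<Longrightarrow> \<bar>2 * Y v * Y' v\<bar> \<le> M2"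
    using bdd by blast
  define M where "M = max M1 M2"
  have M: "0 < M" "\<And>v. v \<in> {\<alpha>..\<beta>} \<Longrightarrow> - M \<le> A' v"
    "\<And>v. v \<in> {\<alpha>..\<beta>} \<Longrightarrow> - M \<le> 2 * Y v * Y' v"
    using M1 M2 by (force simp: M_def)+
  have "\<exists>x\<in>{\<alpha>..\<beta>}. \<forall>v\<in>{\<alpha>..\<beta>}. m x \<le> m v"
    using \<alpha>\<beta> by (intro continuous_attains_inf m) auto
  then obtain m0 where m0: "0 < m0" "\<And>v. v \<in> {\<alpha>..\<beta>} \<Longrightarrow> m0 \<le> m v"
    using m_pos by blast
  \<comment> \<open>Chosen so that \<open>m (1 - \<epsilon>) / \<epsilon> \<ge> M\<close>, which is what the barrier inequality for \<open>U\<close> needs.\<close>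
  define \<epsilon> where "\<epsilon> = m0 / (m0 + M)"
  have eps: "0 < \<epsilon>" "\<epsilon> < 1" "(1 - \<epsilon>) / \<epsilon> = M / m0"
  proof -
    have "1 - \<epsilon> = M / (m0 + M)"
      using m0(1) M(1) by (simp add: \<epsilon>_def field_simps)
    then show "0 < \<epsilon>" "\<epsilon> < 1" "(1 - \<epsilon>) / \<epsilon> = M / m0"
      using m0(1) M(1) by (simp_all add: \<epsilon>_def)
  qed

  define W where "W v = (1 - \<epsilon>) * A v + \<epsilon> * (Y v)\<^sup>2" for v
  define W' where "W' v = (1 - \<epsilon>) * A' v + \<epsilon> * (2 * Y v * Y' v)" for v
  define U where "U v = sqrt (W v)" for v
  define \<Delta> where "\<Delta> v = A v - (Y v)\<^sup>2" for v
  define c where "c v z = max (Y v) (min (U v) z)" for v z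
  define H where "H v z = - (m v * (c v z - Y v) / (A v - (c v z)\<^sup>2))" for v z
  define L where "L v = m v * (1 / (\<epsilon> * \<Delta> v) + U v * (2 * U v) / (\<epsilon> * \<Delta> v)\<^sup>2)" for v
  have W: "(W has_real_derivative W' v) (at v)" if "v \<in> {\<alpha>..\<beta>}" for v
    unfolding W_def W'_def
    by (auto intro!: derivative_eq_intros A[OF that] Y[OF that] simp: algebra_simps)
  have W_ge: "- M \<le> W' v" if "v \<in> {\<alpha>..\<beta>}" for v
  proof -
    have "(1 - \<epsilon>) * - M + \<epsilon> * - M \<le> W' v"
      unfolding W'_def using eps M(2,3)[OF that] by (intro add_mono mult_left_mono) auto
    then show ?thesis by (simp add: algebra_simps)
  qed
  have WA: "A v - W v = \<epsilon> * \<Delta> v" "W v - (Y v)\<^sup>2 = (1 - \<epsilon>) * \<Delta> v" for v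
    by (auto simp: W_def \<Delta>_def algebra_simps)
  have Delta_pos: "0 < \<Delta> v" if "v \<in> {\<alpha><..<\<beta>}" for v
    using gap[OF that] by (simp add: \<Delta>_def)
  have W_pos: "0 < W v" and YU: "Y v \<le> U v" and U2: "(U v)\<^sup>2 = W v" and U_pos: "0 < U v"
    if "v \<in> {\<alpha><..<\<beta>}" for v
  proof -
    have "(Y v)\<^sup>2 \<le> W v"
      using WA(2)[of v] Delta_pos[OF that] eps mult_pos_pos[of "1 - \<epsilon>" "\<Delta> v"] by linarith
    moreover have "0 < Y v" using Y_pos that by simp
    moreover have "0 < W v"
      using calculation zero_less_power[of "Y v" 2] by linarith
    ultimately show "0 < W v" "Y v \<le> U v" "(U v)\<^sup>2 = W v" "0 < U v"
      by (auto simp: U_def real_le_rsqrt)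
  qed
  have U: "(U has_real_derivative W' v / (2 * U v)) (at v)" if "v \<in> {\<alpha><..<\<beta>}" for v
    unfolding U_def using W_pos[OF that] W[of v] that
    by (auto intro!: derivative_eq_intros simp: divide_simps)
  have c_in: "Y v \<le> c v z" "c v z \<le> U v" if "v \<in> {\<alpha><..<\<beta>}" for v z
    using YU[OF that] by (auto simp: c_def)
  have den: "\<epsilon> * \<Delta> v \<le> A v - (c v z)\<^sup>2" "0 < \<epsilon> * \<Delta> v" if "v \<in> {\<alpha><..<\<beta>}" for v z
  proof -
    have "0 < Y v" using Y_pos that by simp
    then have "0 \<le> c v z" using c_in(1)[OF that, of z] by linarith
    then have "(c v z)\<^sup>2 \<le> (U v)\<^sup>2" using c_in(2)[OF that] by (intro power_mono)
    then show "\<epsilon> * \<Delta> v \<le> A v - (c v z)\<^sup>2" using WA(1)[of v] U2[OF that] by linarith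
    show "0 < \<epsilon> * \<Delta> v" using eps Delta_pos[OF that] by simp
  qed
  have nz: "A v - (c v z)\<^sup>2 \<noteq> 0" if "v \<in> {\<alpha><..<\<beta>}" for v z
    using den(1)[OF that, of z] den(2)[OF that] by linarith
  have cont_open: "continuous_on {\<alpha><..<\<beta>} A" "continuous_on {\<alpha><..<\<beta>} Y" "continuous_on {\<alpha><..<\<beta>} m"
    by (rule continuous_on_subset[OF cA] continuous_on_subset[OF cY] continuous_on_subset[OF m]; force)+
  have cU: "continuous_on {\<alpha><..<\<beta>} U"
    unfolding U_def W_def by (intro continuous_intros cont_open)
  show thesis
  proof (rule solution_from_squeezed_endpoint[OF \<alpha>\<beta>, of H L Y Y' U "\<lambda>v. W' v / (2 * U v)"])
    have fst_cont: "continuous_on ({\<alpha><..<\<beta>} \<times> (UNIV :: real set)) (\<lambda>p. f (fst p))"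
      if "continuous_on {\<alpha><..<\<beta>} f" for f :: "real \<Rightarrow> real"
      by (rule continuous_on_compose2[OF that continuous_on_fst[OF continuous_on_id]]) auto
    have "continuous_on ({\<alpha><..<\<beta>} \<times> UNIV) (\<lambda>p. H (fst p) (snd p))"
      unfolding H_def c_def
      by (intro continuous_intros fst_cont cont_open cU)
        (use nz[unfolded c_def] in auto)
    then show "continuous_on ({\<alpha><..<\<beta>} \<times> UNIV) (\<lambda>(t, z). H t z)"
      by (simp add: case_prod_beta')
    show "continuous_on {\<alpha><..<\<beta>} L"
      unfolding L_def \<Delta>_def
      by (intro continuous_intros cont_open cU) (use den(2) in \<open>force simp flip: \<Delta>_def\<close>)+
    fix v assume v: "v \<in> {\<alpha><..<\<beta>}"
    then have v': "v \<in> {\<alpha>..\<beta>}" by simp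
    have Yv: "0 < Y v" and mv: "0 < m v" using Y_pos m_pos v' by auto
    note den_v = den[OF v] and c_v = c_in[OF v]
    show "(Y has_real_derivative Y' v) (at v)" by (rule Y[OF v'])
    show "(U has_real_derivative W' v / (2 * U v)) (at v)" by (rule U[OF v])
    show "Y v \<le> U v" by (rule YU[OF v])
    show "Y' v \<le> H v (Y v)" using YU[OF v] Y_decr[OF v'] by (simp add: H_def c_def)
    show "H v (U v) \<le> W' v / (2 * U v)"
    proof -
      have "(U v - Y v) * (U v + Y v) = (1 - \<epsilon>) * \<Delta> v"
        using U2[OF v] WA(2)[of v] by (simp add: algebra_simps power2_eq_square)
      then have "U v - Y v = (1 - \<epsilon>) * \<Delta> v / (U v + Y v)"
        using U_pos[OF v] Yv by (simp add: field_simps)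
      moreover have "c v (U v) = U v" "A v - (U v)\<^sup>2 = \<epsilon> * \<Delta> v"
        using YU[OF v] U2[OF v] WA(1)[of v] by (auto simp: c_def)
      ultimately have "- H v (U v) = m v * ((1 - \<epsilon>) / \<epsilon>) / (U v + Y v)"
        using Delta_pos[OF v] by (simp add: H_def)
      also have "\<dots> = m v * M / m0 / (U v + Y v)"
        by (simp add: eps)
      also have "\<dots> \<ge> M / (2 * U v)"
      proof (rule frac_le)
        show "M \<le> m v * M / m0" using m0(1) m0(2)[OF v'] M(1) by (simp add: field_simps)
      qed (use mv M(1) m0(1) Yv YU[OF v] in auto)
      finally have "H v (U v) \<le> - M / (2 * U v)" by simp
      also have "\<dots> \<le> W' v / (2 * U v)"
        using W_ge[OF v'] U_pos[OF v] by (intro divide_right_mono) auto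
      finally show ?thesis .
    qed
    fix z1 z2
    show "H v z2 \<le> H v z1" if "z1 \<le> z2"
    proof -
      have c12: "c v z1 \<le> c v z2" using that by (auto simp: c_def)
      have "(c v z1)\<^sup>2 \<le> (c v z2)\<^sup>2" using c12 Yv c_v(1)[of z1] by (intro power_mono) auto
      then have "m v * (c v z1 - Y v) / (A v - (c v z1)\<^sup>2) \<le> m v * (c v z2 - Y v) / (A v - (c v z2)\<^sup>2)"
        using c12 mv c_v[of z2] den_v(1)[of z2] den_v(2)
        by (intro frac_le mult_left_mono) auto
      then show ?thesis by (simp add: H_def)
    qed
    show "\<bar>H v z1 - H v z2\<bar> \<le> L v * \<bar>z1 - z2\<bar>"
    proof -
      let ?e = "\<epsilon> * \<Delta> v" and ?c1 = "c v z1" and ?c2 = "c v z2"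
      have d1: "?e \<le> A v - ?c1\<^sup>2" "0 < A v - ?c1\<^sup>2" and d2: "?e \<le> A v - ?c2\<^sup>2" "0 < A v - ?c2\<^sup>2"
        using den_v(1)[of z1] den_v(1)[of z2] den_v(2) by linarith+
      \<comment> \<open>Both denominators are at least \<open>\<epsilon> \<Delta>\<close> thanks to the cut-off.\<close>
      have "H v z1 - H v z2 = - m v * ((?c1 - ?c2) / (A v - ?c1\<^sup>2)
          + (?c2 - Y v) * ((?c1 - ?c2) * (?c1 + ?c2)) / ((A v - ?c1\<^sup>2) * (A v - ?c2\<^sup>2)))"
        using d1(2) d2(2) unfolding H_def
        by (simp add: divide_simps) (simp add: algebra_simps power2_eq_square)
      then have "\<bar>H v z1 - H v z2\<bar> \<le> m v * (\<bar>(?c1 - ?c2) / (A v - ?c1\<^sup>2)\<bar>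
          + \<bar>(?c2 - Y v) * ((?c1 - ?c2) * (?c1 + ?c2)) / ((A v - ?c1\<^sup>2) * (A v - ?c2\<^sup>2))\<bar>)"
        using mv by (simp only: abs_mult abs_minus_cancel abs_of_pos)
          (intro mult_left_mono abs_triangle_ineq, auto)
      also have "\<dots> \<le> m v * (\<bar>?c1 - ?c2\<bar> * (1 / ?e) + \<bar>?c1 - ?c2\<bar> * (U v * (2 * U v) / ?e\<^sup>2))"
      proof (intro mult_left_mono add_mono)
        show "\<bar>(?c1 - ?c2) / (A v - ?c1\<^sup>2)\<bar> \<le> \<bar>?c1 - ?c2\<bar> * (1 / ?e)"
          using d1 den_v(2) by (auto simp: abs_divide intro!: divide_left_mono)
        have num: "\<bar>?c2 - Y v\<bar> * (?c1 + ?c2) \<le> U v * (2 * U v)"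
          using c_v[of z1] c_v[of z2] Yv by (intro mult_mono) auto
        have "\<bar>?c1 - ?c2\<bar> * (\<bar>?c2 - Y v\<bar> * (?c1 + ?c2)) / ((A v - ?c1\<^sup>2) * (A v - ?c2\<^sup>2))
            \<le> \<bar>?c1 - ?c2\<bar> * (U v * (2 * U v)) / (?e * ?e)"
        proof (rule frac_le)
          show "?e * ?e \<le> (A v - ?c1\<^sup>2) * (A v - ?c2\<^sup>2)"
            using d1 d2 den_v(2) by (intro mult_mono) auto
        qed (use num den_v(2) U_pos[OF v] in \<open>auto intro!: mult_left_mono mult_nonneg_nonneg\<close>)
        moreover have "0 < ?c1 + ?c2" using c_v(1)[of z1] c_v(1)[of z2] Yv by linarith
        ultimately show "\<bar>(?c2 - Y v) * ((?c1 - ?c2) * (?c1 + ?c2)) / ((A v - ?c1\<^sup>2) * (A v - ?c2\<^sup>2))\<bar>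
            \<le> \<bar>?c1 - ?c2\<bar> * (U v * (2 * U v) / ?e\<^sup>2)"
          using d1(2) d2(2) by (simp add: abs_mult abs_divide power2_eq_square mult_ac)
      qed (use mv in auto)
      also have "\<dots> = L v * \<bar>?c1 - ?c2\<bar>"
        by (simp add: L_def algebra_simps)
      also have "\<dots> \<le> L v * \<bar>z1 - z2\<bar>"
        using mv den_v(2) by (intro mult_left_mono) (auto simp: c_def L_def)
      finally show ?thesis .
    qed
  next
    have "isCont W \<alpha>" "isCont Y \<alpha>"
      using \<alpha>\<beta> by (auto intro!: DERIV_isCont[OF W] DERIV_isCont[OF Y])
    then have "isCont (\<lambda>v. U v - Y v) \<alpha>"
      unfolding U_def by (intro continuous_intros)
    then have "((\<lambda>v. U v - Y v) \<longlongrightarrow> U \<alpha> - Y \<alpha>) (at \<alpha>)"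
      by (simp add: isCont_def)
    moreover have "U \<alpha> = Y \<alpha>"
      using Y_pos[of \<alpha>] \<alpha>\<beta> by (simp add: U_def W_def meet flip: distrib_right)
    ultimately show "((\<lambda>v. U v - Y v) \<longlongrightarrow> 0) (at_right \<alpha>)"
      by (simp add: filterlim_at_split)
  next
    fix y assume y: "\<And>v. v \<in> {\<alpha><..<\<beta>} \<Longrightarrow> Y v \<le> y v \<and> y v \<le> U v"
      and y': "\<And>v. v \<in> {\<alpha><..<\<beta>} \<Longrightarrow> (y has_real_derivative H v (y v)) (at v)"
    have c_y: "c v (y v) = y v" if "v \<in> {\<alpha><..<\<beta>}" for v
      using y[OF that] by (auto simp: c_def)
    show thesis
    proof (rule that[of y])
      fix v assume v: "v \<in> {\<alpha><..<\<beta>}"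
      show "Y v \<le> y v \<and> (y v)\<^sup>2 < A v"
        using y[OF v] den(1)[OF v, of "y v"] den(2)[OF v] by (simp add: c_y[OF v])
      show "(y has_real_derivative - (m v * (y v - Y v) / (A v - (y v)\<^sup>2))) (at v)"
        using y'[OF v] by (simp add: H_def c_y[OF v])
    qed
  qed
qed

text \<open>
  For \<open>\<sigma> = - 1\<close> the contracting direction is that of decreasing \<open>v\<close>, and the reflection \<open>v \<mapsto> - v\<close> reduces
  this case to \<open>\<sigma> = 1\<close>.
\<close>
lemma integral_curve_between_nullclines_signed:
  fixes A A' Y Y' m :: "real \<Rightarrow> real"
  assumes \<sigma>: "\<sigma> = 1 \<or> \<sigma> = - 1" and \<alpha>\<beta>: "\<alpha> < \<beta>"
    and A: "\<And>v. v \<in> {\<alpha>..\<beta>} \<Longrightarrow> (A has_real_derivative A' v) (at v)"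
    and Y: "\<And>v. v \<in> {\<alpha>..\<beta>} \<Longrightarrow> (Y has_real_derivative Y' v) (at v)"
    and A': "continuous_on {\<alpha>..\<beta>} A'" and Y': "continuous_on {\<alpha>..\<beta>} Y'"
    and m: "continuous_on {\<alpha>..\<beta>} m"
    and m_pos: "\<And>v. v \<in> {\<alpha>..\<beta>} \<Longrightarrow> 0 < m v"
    and Y_pos: "\<And>v. v \<in> {\<alpha>..\<beta>} \<Longrightarrow> 0 < Y v"
    and Y_mono: "\<And>v. v \<in> {\<alpha>..\<beta>} \<Longrightarrow> \<sigma> * Y' v \<le> 0"
    and gap: "\<And>v. v \<in> {\<alpha><..<\<beta>} \<Longrightarrow> (Y v)\<^sup>2 < A v"
    and meet: "A \<alpha> = (Y \<alpha>)\<^sup>2" "A \<beta> = (Y \<beta>)\<^sup>2"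
  obtains y where "\<And>v. v \<in> {\<alpha><..<\<beta>} \<Longrightarrow> Y v \<le> y v \<and> (y v)\<^sup>2 < A v"
    and "\<And>v. v \<in> {\<alpha><..<\<beta>} \<Longrightarrow>
           (y has_real_derivative - \<sigma> * (m v * (y v - Y v) / (A v - (y v)\<^sup>2))) (at v)"
  using \<sigma>
proof
  assume "\<sigma> = 1"
  then show thesis
    using integral_curve_between_nullclines[OF \<alpha>\<beta> A Y A' Y' m m_pos Y_pos _ gap meet(1)] Y_mono that
    by (auto simp del: atLeastAtMost_iff greaterThanLessThan_iff)
next
  assume \<sigma>: "\<sigma> = - 1"
  have cont_neg: "continuous_on {-\<beta>..-\<alpha>} (\<lambda>v. f (- v))" if "continuous_on {\<alpha>..\<beta>} f" for f :: "real \<Rightarrow> real"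
    by (rule continuous_on_compose2[OF that]) (auto intro!: continuous_intros)
  have der_neg: "((\<lambda>v. f (- v)) has_real_derivative - D) (at v)"
    if "(f has_real_derivative D) (at (- v))" for f :: "real \<Rightarrow> real" and D v
    using that DERIV_mirror[of f D v] by simp
  show thesis
  proof (rule integral_curve_between_nullclines[of "- \<beta>" "- \<alpha>" "\<lambda>v. A (- v)" "\<lambda>v. - A' (- v)"
        "\<lambda>v. Y (- v)" "\<lambda>v. - Y' (- v)" "\<lambda>v. m (- v)"])
    fix y assume y: "\<And>v. v \<in> {- \<beta><..<- \<alpha>} \<Longrightarrow> Y (- v) \<le> y v \<and> (y v)\<^sup>2 < A (- v)"
      and y': "\<And>v. v \<in> {- \<beta><..<- \<alpha>} \<Longrightarrow>
        (y has_real_derivative - (m (- v) * (y v - Y (- v)) / (A (- v) - (y v)\<^sup>2))) (at v)"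
    show thesis
    proof (rule that[of "\<lambda>v. y (- v)"])
      fix v assume v: "v \<in> {\<alpha><..<\<beta>}"
      then have v': "- v \<in> {- \<beta><..<- \<alpha>}" by auto
      show "Y v \<le> y (- v) \<and> (y (- v))\<^sup>2 < A v" using y[OF v'] by simp
      show "((\<lambda>v. y (- v)) has_real_derivative - \<sigma> * (m v * (y (- v) - Y v) / (A v - (y (- v))\<^sup>2))) (at v)"
        using der_neg[OF y'[OF v']] by (simp add: \<sigma>)
    qed
  qed (use \<alpha>\<beta> Y_mono m_pos Y_pos gap meet in
      \<open>auto simp: \<sigma> intro!: der_neg A Y continuous_on_minus cont_neg A' Y' m\<close>)
qed

section \<open>Profiles of a planar system\<close>

text \<open>
  The inverse of \<open>V\<close> is an antiderivative \<open>X\<close> of \<open>- 1 / F\<close>. The linear bounds on \<open>F\<close> make \<open>X\<close> diverge at least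
  logarithmically at both ends, so that \<open>X\<close> maps the interval onto \<open>\<real>\<close>.
\<close>
lemma decreasing_flow_on_interval:
  fixes F :: "real \<Rightarrow> real"
  assumes \<alpha>\<beta>: "\<alpha> < \<beta>"
    and cont: "continuous_on {\<alpha><..<\<beta>} F"
    and pos: "\<And>v. v \<in> {\<alpha><..<\<beta>} \<Longrightarrow> 0 < F v"
    and C: "0 < C"
    and lin_\<alpha>: "\<And>v. v \<in> {\<alpha><..<\<beta>} \<Longrightarrow> F v \<le> C * (v - \<alpha>)"
    and lin_\<beta>: "\<And>v. v \<in> {\<alpha><..<\<beta>} \<Longrightarrow> F v \<le> C * (\<beta> - v)"
  obtains V where "\<And>x. V x \<in> {\<alpha><..<\<beta>}"
    and "\<And>x. (V has_real_derivative - F (V x)) (at x)"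
    and "(V \<longlongrightarrow> \<beta>) at_bot" and "(V \<longlongrightarrow> \<alpha>) at_top"
proof -
  have isCont_inv: "isCont (\<lambda>v. - 1 / F v) v" if "ereal \<alpha> < ereal v" "ereal v < ereal \<beta>" for v
  proof -
    have "isCont F v" using cont that by (simp add: continuous_on_eq_continuous_at)
    then show ?thesis using pos[of v] that by (intro continuous_intros) auto
  qed
  obtain X where X: "\<And>v. v \<in> {\<alpha><..<\<beta>} \<Longrightarrow> (X has_real_derivative - 1 / F v) (at v)"
    using einterval_antiderivative[of "ereal \<alpha>" "ereal \<beta>", OF _ isCont_inv] \<alpha>\<beta>
    by (auto simp: has_real_derivative_iff_has_vector_derivative)
  have X_decr: "X v < X u" if "u \<in> {\<alpha><..<\<beta>}" "v \<in> {\<alpha><..<\<beta>}" "u < v" for u v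
  proof (rule DERIV_neg_imp_decreasing[OF that(3)])
    fix r assume "u \<le> r" "r \<le> v"
    then have "r \<in> {\<alpha><..<\<beta>}" using that by auto
    then show "\<exists>y. (X has_real_derivative y) (at r) \<and> y < 0"
      using X pos[of r] by (intro exI[of _ "- 1 / F r"]) auto
  qed
  define c where "c = (\<alpha> + \<beta>) / 2"
  have c: "c \<in> {\<alpha><..<\<beta>}" using \<alpha>\<beta> by (simp add: c_def)
  have inv_ge: "1 / (C * (v - \<alpha>)) \<le> 1 / F v" "1 / (C * (\<beta> - v)) \<le> 1 / F v" if "v \<in> {\<alpha><..<\<beta>}" for v
    using lin_\<alpha>[OF that] lin_\<beta>[OF that] pos[OF that] C that
    by (auto intro!: divide_left_mono mult_pos_pos)
  \<comment> \<open>Logarithmic divergence of \<open>X\<close>, from comparison with the antiderivatives of the linear bounds.\<close>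
  have X_ge: "X c + (ln (c - \<alpha>) - ln (v - \<alpha>)) / C \<le> X v" if v: "v \<in> {\<alpha><..<\<beta>}" "v \<le> c" for v
  proof -
    have "X c + ln (c - \<alpha>) / C \<le> X v + ln (v - \<alpha>) / C"
    proof (rule DERIV_nonpos_imp_nonincreasing[OF v(2)])
      fix r assume "v \<le> r" "r \<le> c"
      then have r: "r \<in> {\<alpha><..<\<beta>}" using v c by auto
      have "((\<lambda>v. X v + ln (v - \<alpha>) / C) has_real_derivative - 1 / F r + 1 / (C * (r - \<alpha>))) (at r)"
        using r C by (auto intro!: derivative_eq_intros X simp: field_simps)
      then show "\<exists>y. ((\<lambda>v. X v + ln (v - \<alpha>) / C) has_real_derivative y) (at r) \<and> y \<le> 0"
        using inv_ge(1)[OF r] by (intro exI[of _ "- 1 / F r + 1 / (C * (r - \<alpha>))"]) auto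
    qed
    then show ?thesis by (simp add: diff_divide_distrib)
  qed
  have X_le: "X v \<le> X c - (ln (\<beta> - c) - ln (\<beta> - v)) / C" if v: "v \<in> {\<alpha><..<\<beta>}" "c \<le> v" for v
  proof -
    have "X v - ln (\<beta> - v) / C \<le> X c - ln (\<beta> - c) / C"
    proof (rule DERIV_nonpos_imp_nonincreasing[OF v(2)])
      fix r assume "c \<le> r" "r \<le> v"
      then have r: "r \<in> {\<alpha><..<\<beta>}" using v c by auto
      have "((\<lambda>v. X v - ln (\<beta> - v) / C) has_real_derivative - 1 / F r + 1 / (C * (\<beta> - r))) (at r)"
        using r C by (auto intro!: derivative_eq_intros X simp: field_simps)
      then show "\<exists>y. ((\<lambda>v. X v - ln (\<beta> - v) / C) has_real_derivative y) (at r) \<and> y \<le> 0"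
        using inv_ge(2)[OF r] by (intro exI[of _ "- 1 / F r + 1 / (C * (\<beta> - r))"]) auto
    qed
    then show ?thesis by (simp add: diff_divide_distrib)
  qed
  have surj: "\<exists>v\<in>{\<alpha><..<\<beta>}. X v = x" for x
  proof -
    \<comment> \<open>Points so close to the ends that the logarithmic bounds give \<open>X w \<le> x \<le> X u\<close>.\<close>
    define u where "u = \<alpha> + (c - \<alpha>) * exp (- C * \<bar>x - X c\<bar>)"
    define w where "w = \<beta> - (\<beta> - c) * exp (- C * \<bar>x - X c\<bar>)"
    have "exp (- C * \<bar>x - X c\<bar>) \<le> 1" using C by simp
    then have "(c - \<alpha>) * exp (- C * \<bar>x - X c\<bar>) \<le> (c - \<alpha>) * 1"
      "(\<beta> - c) * exp (- C * \<bar>x - X c\<bar>) \<le> (\<beta> - c) * 1"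
      using c by (intro mult_left_mono; simp)+
    moreover have "0 < (c - \<alpha>) * exp (- C * \<bar>x - X c\<bar>)" "0 < (\<beta> - c) * exp (- C * \<bar>x - X c\<bar>)"
      using c by auto
    ultimately have u: "u \<in> {\<alpha><..<\<beta>}" "u \<le> c" and w: "w \<in> {\<alpha><..<\<beta>}" "c \<le> w"
      using c by (simp_all add: u_def w_def)
    have "ln (u - \<alpha>) = ln (c - \<alpha>) - C * \<bar>x - X c\<bar>" "ln (\<beta> - w) = ln (\<beta> - c) - C * \<bar>x - X c\<bar>"
      using c by (auto simp: u_def w_def ln_mult)
    then have "X w \<le> x" "x \<le> X u"
      using X_ge[OF u] X_le[OF w] C by auto
    moreover have "\<forall>v. u \<le> v \<and> v \<le> w \<longrightarrow> isCont X v"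
      using u w by (auto intro!: DERIV_isCont[OF X])
    ultimately obtain v where "u \<le> v" "v \<le> w" "X v = x"
      using IVT2[of X w x u] u w by auto
    then show ?thesis using u w by auto
  qed
  then obtain V where V: "\<And>x. V x \<in> {\<alpha><..<\<beta>}" "\<And>x. X (V x) = x" by metis
  have V_mono: "V x < V y \<longleftrightarrow> y < x" for x y
    using X_decr[of "V x" "V y"] X_decr[of "V y" "V x"] V by (metis less_asym linorder_neqE)
  have V_X: "V (X v) = v" if "v \<in> {\<alpha><..<\<beta>}" for v
    using X_decr[of v "V (X v)"] X_decr[of "V (X v)" v] V[of "X v"] that by (metis less_irrefl linorder_neqE)
  show thesis
  proof
    show "V x \<in> {\<alpha><..<\<beta>}" for x by (rule V)
    show "(V has_real_derivative - F (V x)) (at x)" for x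
    proof -
      have "isCont V x"
      proof -
        define e where "e = min (V x - \<alpha>) (\<beta> - V x) / 2"
        have "e \<le> (V x - \<alpha>) / 2" "e \<le> (\<beta> - V x) / 2" by (auto simp: e_def)
        moreover have "0 < e" "\<alpha> < V x" "V x < \<beta>" using V(1)[of x] by (auto simp: e_def)
        ultimately have e: "0 < e" "\<alpha> < V x - e" "V x + e < \<beta>" by (linarith | simp)+
        have "isCont V (X (V x))"
        proof (rule isCont_inverse_function[where d = e and f = X and x = "V x"])
          show "0 < e" by fact
          show "V (X z) = z" "isCont X z" if "\<bar>z - V x\<bar> \<le> e" for z
          proof -
            have "z \<in> {\<alpha><..<\<beta>}" using e that by auto
            then show "V (X z) = z" "isCont X z" using V_X X DERIV_isCont by blast+
          qed
        qed
        then show ?thesis by (simp add: V)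
      qed
      then have "(V has_real_derivative inverse (- 1 / F (V x))) (at x)"
        using X[OF V(1)[of x]] pos[OF V(1)[of x]] V(2)
        by (intro DERIV_inverse_function[of X _ _ _ "x - 1" "x + 1"]) auto
      then show ?thesis by simp
    qed
    show "(V \<longlongrightarrow> \<beta>) at_bot"
    proof (rule order_tendstoI)
      fix y assume y: "y < \<beta>"
      define y' where "y' = max y c"
      have y': "y' \<in> {\<alpha><..<\<beta>}" "y \<le> y'" using y c by (auto simp: y'_def)
      have "\<forall>\<^sub>F x in at_bot. x < X y'" by (auto simp: eventually_at_bot_dense)
      then show "\<forall>\<^sub>F x in at_bot. y < V x"
      proof eventually_elim
        case (elim x)
        then have "V (X y') < V x" by (simp add: V_mono)
        then show ?case using V_X y' by auto
      qed
    next
      fix y assume "\<beta> < y"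
      then show "\<forall>\<^sub>F x in at_bot. V x < y"
        using V(1) by (intro always_eventually) (auto intro: less_trans)
    qed
    show "(V \<longlongrightarrow> \<alpha>) at_top"
    proof (rule order_tendstoI)
      fix y assume y: "\<alpha> < y"
      define y' where "y' = min y c"
      have y': "y' \<in> {\<alpha><..<\<beta>}" "y' \<le> y" using y c by (auto simp: y'_def)
      have "\<forall>\<^sub>F x in at_top. X y' < x" by (rule eventually_gt_at_top)
      then show "\<forall>\<^sub>F x in at_top. V x < y"
      proof eventually_elim
        case (elim x)
        then have "V x < V (X y')" by (simp add: V_mono)
        then show ?case using V_X y' by auto
      qed
    next
      fix y assume "y < \<alpha>"
      then show "\<forall>\<^sub>F x in at_top. y < V x"
        using V(1) by (intro always_eventually) (auto intro: less_trans)
    qed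
  qed
qed

text \<open>
  The orbit is \<open>E = y \<circ> V\<close>, where the graph \<open>y\<close> solves the equation for \<open>dy/dv\<close> and \<open>V\<close> solves the first component
  restricted to this graph. At the ends \<open>E\<close> is squeezed between the two nullclines, and the velocity of \<open>V\<close> is at
  most a multiple of the width \<open>D = A - Y\<^sup>2\<close>, which is Lipschitz and vanishes there.
\<close>
lemma planar_profile_between_nullclines:
  fixes A A' Y Y' k n :: "real \<Rightarrow> real"
  assumes \<sigma>: "\<sigma> = 1 \<or> \<sigma> = - 1" and \<alpha>\<beta>: "\<alpha> < \<beta>"
    and A: "\<And>v. v \<in> {\<alpha>..\<beta>} \<Longrightarrow> (A has_real_derivative A' v) (at v)"
    and Y: "\<And>v. v \<in> {\<alpha>..\<beta>} \<Longrightarrow> (Y has_real_derivative Y' v) (at v)"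
    and A': "continuous_on {\<alpha>..\<beta>} A'" and Y': "continuous_on {\<alpha>..\<beta>} Y'"
    and k: "continuous_on {\<alpha>..\<beta>} k" and n: "continuous_on {\<alpha>..\<beta>} n"
    and k_pos: "\<And>v. v \<in> {\<alpha>..\<beta>} \<Longrightarrow> 0 < k v"
    and n_pos: "\<And>v. v \<in> {\<alpha>..\<beta>} \<Longrightarrow> 0 < n v"
    and Y_pos: "\<And>v. v \<in> {\<alpha>..\<beta>} \<Longrightarrow> 0 < Y v"
    and Y_mono: "\<And>v. v \<in> {\<alpha>..\<beta>} \<Longrightarrow> \<sigma> * Y' v \<le> 0"
    and gap: "\<And>v. v \<in> {\<alpha><..<\<beta>} \<Longrightarrow> (Y v)\<^sup>2 < A v"
    and meet: "A \<alpha> = (Y \<alpha>)\<^sup>2" "A \<beta> = (Y \<beta>)\<^sup>2"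
  obtains V E where "\<And>x. V x \<in> {\<alpha><..<\<beta>}" and "\<And>x. Y (V x) \<le> E x"
    and "\<And>x. (V has_real_derivative - (k (V x) * (A (V x) - (E x)\<^sup>2))) (at x)"
    and "\<And>x. (E has_real_derivative \<sigma> * (n (V x) * (E x - Y (V x)))) (at x)"
    and "(V \<longlongrightarrow> \<beta>) at_bot" and "(V \<longlongrightarrow> \<alpha>) at_top"
    and "(E \<longlongrightarrow> Y \<beta>) at_bot" and "(E \<longlongrightarrow> Y \<alpha>) at_top"
    and "antimono V" and "mono (\<lambda>x. \<sigma> * E x)"
proof -
  obtain y where y: "\<And>v. v \<in> {\<alpha><..<\<beta>} \<Longrightarrow> Y v \<le> y v \<and> (y v)\<^sup>2 < A v"
    and y': "\<And>v. v \<in> {\<alpha><..<\<beta>} \<Longrightarrow>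
      (y has_real_derivative - \<sigma> * (n v / k v * (y v - Y v) / (A v - (y v)\<^sup>2))) (at v)"
  proof (rule integral_curve_between_nullclines_signed[OF \<sigma> \<alpha>\<beta> A Y A' Y' _ _ Y_pos Y_mono gap meet,
        of "\<lambda>v. n v / k v"])
    show "continuous_on {\<alpha>..\<beta>} (\<lambda>v. n v / k v)"
      using k_pos by (intro continuous_on_divide n k) force
  qed (use n_pos k_pos in auto)
  define F where "F v = k v * (A v - (y v)\<^sup>2)" for v
  have cA: "isCont A v" and cY: "isCont Y v" if "v \<in> {\<alpha>..\<beta>}" for v
    using A Y that DERIV_isCont by blast+
  have F_pos: "0 < F v" if "v \<in> {\<alpha><..<\<beta>}" for v
    using k_pos[of v] y[OF that] that by (simp add: F_def)
  have cont_F: "continuous_on {\<alpha><..<\<beta>} F"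
    unfolding F_def
  proof (intro continuous_intros)
    show "continuous_on {\<alpha><..<\<beta>} k" by (rule continuous_on_subset[OF k]) auto
    show "continuous_on {\<alpha><..<\<beta>} A" "continuous_on {\<alpha><..<\<beta>} y"
      using cA by (auto intro!: continuous_at_imp_continuous_on DERIV_isCont[OF y'])
  qed
  have bdd: "\<exists>C>0. \<forall>v\<in>{\<alpha>..\<beta>}. \<bar>f v\<bar> \<le> C" if "continuous_on {\<alpha>..\<beta>} f" for f :: "real \<Rightarrow> real"
    using compact_imp_bounded[OF compact_continuous_image[OF that compact_Icc]]
    by (auto simp: bounded_pos)
  define D where "D v = A v - (Y v)\<^sup>2" for v
  define D' where "D' v = A' v - 2 * Y v * Y' v" for v
  have D: "(D has_real_derivative D' v) (at v)" if "v \<in> {\<alpha>..\<beta>}" for v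
    unfolding D_def D'_def by (auto intro!: derivative_eq_intros A[OF that] Y[OF that])
  have "continuous_on {\<alpha>..\<beta>} D'"
    unfolding D'_def using cY by (intro continuous_intros A' Y') (auto intro: continuous_at_imp_continuous_on)
  then obtain C1 where C1: "0 < C1" "\<And>v. v \<in> {\<alpha>..\<beta>} \<Longrightarrow> \<bar>D' v\<bar> \<le> C1" using bdd by blast
  obtain C2 where C2: "0 < C2" "\<And>v. v \<in> {\<alpha>..\<beta>} \<Longrightarrow> \<bar>k v\<bar> \<le> C2" using bdd[OF k] by blast
  have D_lip: "D w - D u \<le> C1 * (w - u)" "D u - D w \<le> C1 * (w - u)"
    if uw: "\<alpha> \<le> u" "u < w" "w \<le> \<beta>" for u w
  proof -
    obtain z where z: "u < z" "z < w" "D w - D u = (w - u) * D' z"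
      using MVT2[of u w D D'] D uw by auto
    have "\<bar>D' z\<bar> \<le> C1" using C1(2) z uw by auto
    then have "\<bar>(w - u) * D' z\<bar> \<le> (w - u) * C1"
      using uw by (simp add: abs_mult mult_left_mono)
    then show "D w - D u \<le> C1 * (w - u)" "D u - D w \<le> C1 * (w - u)"
      using z(3) by (auto simp: mult.commute)
  qed
  have F_le: "F v \<le> C2 * D v" if "v \<in> {\<alpha><..<\<beta>}" for v
  proof -
    have "(Y v)\<^sup>2 \<le> (y v)\<^sup>2" using y[OF that] Y_pos[of v] that by (intro power_mono) auto
    then show ?thesis unfolding F_def D_def
      using k_pos[of v] C2(2)[of v] y[OF that] that by (intro mult_mono) auto
  qed
  have D_ends: "D \<alpha> = 0" "D \<beta> = 0" using meet by (auto simp: D_def)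
  obtain V where V: "\<And>x. V x \<in> {\<alpha><..<\<beta>}" and V': "\<And>x. (V has_real_derivative - F (V x)) (at x)"
    and V_bot: "(V \<longlongrightarrow> \<beta>) at_bot" and V_top: "(V \<longlongrightarrow> \<alpha>) at_top"
  proof (rule decreasing_flow_on_interval[OF \<alpha>\<beta> cont_F F_pos, of "C2 * C1"])
    show "0 < C2 * C1" using C1 C2 by simp
    fix v assume v: "v \<in> {\<alpha><..<\<beta>}"
    have "C2 * D v \<le> C2 * (C1 * (v - \<alpha>))" "C2 * D v \<le> C2 * (C1 * (\<beta> - v))"
      using D_lip(1)[of \<alpha> v] D_lip(2)[of v \<beta>] D_ends v C2(1) by auto
    then show "F v \<le> C2 * C1 * (v - \<alpha>)" "F v \<le> C2 * C1 * (\<beta> - v)"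
      using F_le[OF v] by (auto simp: mult.assoc)
  qed (rule that | assumption)+
  define E where "E x = y (V x)" for x
  have E': "(E has_real_derivative \<sigma> * (n (V x) * (E x - Y (V x)))) (at x)" for x
  proof -
    let ?v = "V x"
    have "k ?v > 0" "A ?v - (y ?v)\<^sup>2 > 0" using k_pos[of ?v] V[of x] y[OF V[of x]] by auto
    then have "- \<sigma> * (n ?v / k ?v * (y ?v - Y ?v) / (A ?v - (y ?v)\<^sup>2)) * - F ?v
        = \<sigma> * (n ?v * (y ?v - Y ?v))"
      by (simp add: F_def)
    then show ?thesis
      using DERIV_chain2[OF y'[OF V[of x]] V'[of x]] by (simp add: E_def[abs_def])
  qed
  have E_le: "E x \<le> sqrt (A (V x))" for x
    using y[OF V[of x]] by (intro real_le_rsqrt) (simp add: E_def)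
  have E_lim: "(E \<longlongrightarrow> Y e) G" if "(V \<longlongrightarrow> e) G" "e \<in> {\<alpha>, \<beta>}" for e G
  proof (rule tendsto_sandwich)
    have e: "e \<in> {\<alpha>..\<beta>}" "sqrt (A e) = Y e" using that(2) \<alpha>\<beta> meet Y_pos[of e] by auto
    show "((\<lambda>x. Y (V x)) \<longlongrightarrow> Y e) G" by (rule isCont_tendsto_compose[OF cY[OF e(1)] that(1)])
    show "((\<lambda>x. sqrt (A (V x))) \<longlongrightarrow> Y e) G"
      using tendsto_real_sqrt[OF isCont_tendsto_compose[OF cA[OF e(1)] that(1)]] e(2) by simp
  qed (use y V E_le in \<open>auto simp: E_def intro!: always_eventually\<close>)
  show thesis
  proof
    show "V x \<in> {\<alpha><..<\<beta>}" for x by (rule V)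
    show "Y (V x) \<le> E x" for x using y[OF V[of x]] by (simp add: E_def)
    show "(V has_real_derivative - (k (V x) * (A (V x) - (E x)\<^sup>2))) (at x)" for x
      using V'[of x] by (simp add: F_def E_def)
    show "(E has_real_derivative \<sigma> * (n (V x) * (E x - Y (V x)))) (at x)" for x by (rule E')
    show "(V \<longlongrightarrow> \<beta>) at_bot" "(V \<longlongrightarrow> \<alpha>) at_top" by fact+
    show "(E \<longlongrightarrow> Y \<beta>) at_bot" "(E \<longlongrightarrow> Y \<alpha>) at_top"
      using E_lim V_bot V_top by auto
    show "antimono V"
    proof (rule antimonoI)
      fix x z :: real assume "x \<le> z"
      then show "V z \<le> V x"
        using V' F_pos[OF V] by (intro DERIV_nonpos_imp_nonincreasing[of x z V]) (auto intro!: exI less_imp_le)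
    qed
    show "mono (\<lambda>x. \<sigma> * E x)"
    proof (rule monoI)
      fix x z :: real assume "x \<le> z"
      moreover have "\<exists>d. ((\<lambda>x. \<sigma> * E x) has_real_derivative d) (at r) \<and> 0 \<le> d" for r
      proof (intro exI conjI)
        show "((\<lambda>x. \<sigma> * E x) has_real_derivative \<sigma> * (\<sigma> * (n (V r) * (E r - Y (V r))))) (at r)"
          by (rule DERIV_cmult[OF E'])
        have "0 \<le> n (V r) * (E r - Y (V r))"
          using n_pos[of "V r"] V[of r] y[OF V[of r]] by (simp add: E_def)
        then show "0 \<le> \<sigma> * (\<sigma> * (n (V r) * (E r - Y (V r))))" using \<sigma> by auto
      qed
      ultimately show "\<sigma> * E x \<le> \<sigma> * E z"
        by (intro DERIV_nonneg_imp_nondecreasing[of x z "\<lambda>x. \<sigma> * E x"]) auto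
    qed
  qed
qed

section \<open>Eigenvalues of real two-by-two matrices\<close>

lemma eigenvalue_of_iff:
  fixes p q r s :: real
  shows "eigenvalue_of (vector [vector [p, q], vector [r, s]]) l \<longleftrightarrow>
    (l - complex_of_real p) * (l - complex_of_real s) = complex_of_real (q * r)"
proof
  let ?A = "vector [vector [p, q], vector [r, s]] :: real^2^2"
  let ?P = "complex_of_real p" and ?Q = "complex_of_real q"
  let ?R = "complex_of_real r" and ?S = "complex_of_real s"
  have eq: "map_matrix complex_of_real ?A *v z = l *s z \<longleftrightarrow>
      ?P * z $ 1 + ?Q * z $ 2 = l * z $ 1 \<and> ?R * z $ 1 + ?S * z $ 2 = l * z $ 2" for z :: "complex^2"
    by (simp add: vec_eq_iff forall_2 matrix_vector_mult_def sum_2 map_matrix_def)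
  have z0: "z \<noteq> 0 \<longleftrightarrow> z $ 1 \<noteq> 0 \<or> z $ 2 \<noteq> 0" for z :: "complex^2"
    by (auto simp: vec_eq_iff forall_2)
  show "(l - ?P) * (l - ?S) = complex_of_real (q * r)" if ev: "eigenvalue_of ?A l"
  proof -
    obtain z :: "complex^2" where nz: "z \<noteq> 0" and "map_matrix complex_of_real ?A *v z = l *s z"
      using ev unfolding eigenvalue_of_def by blast
    then have z: "?P * z $ 1 + ?Q * z $ 2 = l * z $ 1" "?R * z $ 1 + ?S * z $ 2 = l * z $ 2"
      by (simp_all only: eq)
    have z': "(l - ?P) * z $ 1 = ?Q * z $ 2" "(l - ?S) * z $ 2 = ?R * z $ 1"
      unfolding left_diff_distrib z[symmetric] by simp_all
    have "((l - ?P) * (l - ?S) - ?Q * ?R) * z $ 1 = (l - ?S) * ((l - ?P) * z $ 1) - ?Q * (?R * z $ 1)"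
      by (simp add: algebra_simps)
    also have "\<dots> = 0" by (simp add: z'(1) z'(2)[symmetric])
    finally have 1: "((l - ?P) * (l - ?S) - ?Q * ?R) * z $ 1 = 0" .
    have "((l - ?P) * (l - ?S) - ?Q * ?R) * z $ 2 = (l - ?P) * ((l - ?S) * z $ 2) - ?R * (?Q * z $ 2)"
      by (simp add: algebra_simps)
    also have "\<dots> = 0" by (simp add: z'(2) z'(1)[symmetric])
    finally have "((l - ?P) * (l - ?S) - ?Q * ?R) * z $ 2 = 0" .
    with 1 show ?thesis using nz by (auto simp: z0)
  qed
  show "eigenvalue_of ?A l" if det: "(l - ?P) * (l - ?S) = complex_of_real (q * r)"
  proof -
    have det': "(l - ?P) * (l - ?S) = ?Q * ?R" using det by simp
    have witness: "eigenvalue_of ?A l"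
      if "a \<noteq> 0 \<or> b \<noteq> 0" "?P * a + ?Q * b = l * a" "?R * a + ?S * b = l * b" for a b
      unfolding eigenvalue_of_def
      by (rule exI[of _ "vector [a, b]"]) (use that in \<open>simp add: eq z0\<close>)
    \<comment> \<open>An eigenvector is obtained from a nonzero row of the singular matrix \<open>A - l\<close>, or is arbitrary if both rows vanish.\<close>
    show ?thesis
    proof (cases "?Q \<noteq> 0 \<or> l \<noteq> ?P")
      case True
      then show ?thesis by (intro witness[of ?Q "l - ?P"]) (use det' in \<open>auto simp: algebra_simps\<close>)
    next
      case False
      then show ?thesis
      proof (cases "l = ?S \<and> ?R = 0")
        case True
        then show ?thesis using False by (intro witness[of 1 0]) auto
      next
        case ls: False
        then show ?thesis using False by (intro witness[of "l - ?S" ?R]) (auto simp: algebra_simps)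
      qed
    qed
  qed
qed

text \<open>
  The discriminant of the characteristic polynomial is \<open>(p - s)\<^sup>2 + 4 q r\<close>, which is nonnegative here.
\<close>
lemma eigenvalue_of_real:
  fixes p q r s :: real
  assumes qr: "0 \<le> q * r" and l: "eigenvalue_of (vector [vector [p, q], vector [r, s]]) l"
  shows "l \<in> \<real>" and "(Re l - p) * (Re l - s) = q * r"
proof -
  have e: "(l - complex_of_real p) * (l - complex_of_real s) = complex_of_real (q * r)"
    using l by (simp add: eigenvalue_of_iff)
  have re: "(Re l - p) * (Re l - s) - Im l * Im l = q * r"
    using arg_cong[OF e, of Re] by (simp add: algebra_simps)
  have im: "Im l * (2 * Re l - p - s) = 0"
    using arg_cong[OF e, of Im] by (simp add: algebra_simps)
  have "Im l = 0"
  proof (rule ccontr)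
    assume "Im l \<noteq> 0"
    then have "2 * Re l - p - s = 0" using im by simp
    then have h: "Re l - p = - ((p - s) / 2)" "Re l - s = (p - s) / 2"
      by (simp_all add: field_simps)
    have "- ((p - s) / 2)\<^sup>2 - (Im l)\<^sup>2 = q * r"
      using re unfolding h by (simp add: power2_eq_square)
    moreover have "0 < (Im l)\<^sup>2" using \<open>Im l \<noteq> 0\<close> by simp
    moreover have "0 \<le> ((p - s) / 2)\<^sup>2" by simp
    ultimately show False using qr by linarith
  qed
  then show "l \<in> \<real>" "(Re l - p) * (Re l - s) = q * r"
    using re by (auto simp: complex_is_Real_iff)
qed

lemma eigenvalues_positive:
  fixes p q r s :: real
  assumes qr: "0 \<le> q * r" and det: "q * r < p * s" and s: "0 < s"
    and l: "eigenvalue_of (vector [vector [p, q], vector [r, s]]) l"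
  shows "l \<in> \<real> \<and> 0 < Re l"
proof -
  have p: "0 < p"
  proof (rule ccontr)
    assume "\<not> 0 < p"
    then have "p * s \<le> 0" using s by (intro mult_nonpos_nonneg) auto
    then show False using qr det by linarith
  qed
  have "0 < Re l"
  proof (rule ccontr)
    assume "\<not> 0 < Re l"
    then have "p * s \<le> (p - Re l) * (s - Re l)" using p s by (intro mult_mono) auto
    then show False using eigenvalue_of_real(2)[OF qr l] det by (simp add: algebra_simps)
  qed
  then show ?thesis using eigenvalue_of_real(1)[OF qr l] by simp
qed

lemma eigenvalues_negative:
  fixes p q r s :: real
  assumes qr: "0 \<le> q * r" and det: "q * r < p * s" and s: "s < 0"
    and l: "eigenvalue_of (vector [vector [p, q], vector [r, s]]) l"
  shows "l \<in> \<real> \<and> Re l < 0"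
proof -
  have p: "p < 0"
  proof (rule ccontr)
    assume "\<not> p < 0"
    then have "p * s \<le> 0" using s by (intro mult_nonneg_nonpos) auto
    then show False using qr det by linarith
  qed
  have "Re l < 0"
  proof (rule ccontr)
    assume "\<not> Re l < 0"
    then have "(- p) * (- s) \<le> (Re l - p) * (Re l - s)" using p s by (intro mult_mono) auto
    then show False using eigenvalue_of_real(2)[OF qr l] det by simp
  qed
  then show ?thesis using eigenvalue_of_real(1)[OF qr l] by simp
qed

lemma eigenvalues_opposite:
  fixes p q r s :: real
  assumes det: "p * s < q * r"
  shows "\<exists>l1 l2. l1 < 0 \<and> 0 < l2 \<and>
    eigenvalue_of (vector [vector [p, q], vector [r, s]]) (complex_of_real l1) \<and>
    eigenvalue_of (vector [vector [p, q], vector [r, s]]) (complex_of_real l2)"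
proof -
  define D where "D = (p + s)\<^sup>2 + 4 * (q * r - p * s)"
  have "\<bar>p + s\<bar> < sqrt D"
    using det by (intro real_less_rsqrt) (simp add: D_def)
  then have sgn: "(p + s - sqrt D) / 2 < 0" "0 < (p + s + sqrt D) / 2"
    by (simp_all add: abs_less_iff)
  have root: "eigenvalue_of (vector [vector [p, q], vector [r, s]]) (complex_of_real ((p + s + e) / 2))"
    if "e * e = D" for e
  proof -
    have "4 * (((p + s + e) / 2 - p) * ((p + s + e) / 2 - s)) = (s - p + e) * (p - s + e)"
      by (simp add: field_simps)
    also have "\<dots> = 4 * (q * r)"
      using that by (simp add: D_def algebra_simps power2_eq_square)
    finally have "((p + s + e) / 2 - p) * ((p + s + e) / 2 - s) = q * r" by simp
    then show ?thesis by (simp only: eigenvalue_of_iff flip: of_real_diff of_real_mult)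
  qed
  have "0 \<le> D" using det by (simp add: D_def)
  then have "eigenvalue_of (vector [vector [p, q], vector [r, s]]) (complex_of_real ((p + s + sqrt D) / 2))"
    "eigenvalue_of (vector [vector [p, q], vector [r, s]]) (complex_of_real ((p + s - sqrt D) / 2))"
    using root[of "sqrt D"] root[of "- sqrt D"] by simp_all
  with sgn show ?thesis by blast
qed

section \<open>Rest points of the traveling-wave field\<close>

lemma tw_field_components:
  "tw_field a \<gamma> \<mu>0 I B \<mu> \<tau> Z $ 1 =
     (Z $ 1 * (Z $ 1 - 1) + Z $ 1 * (a * Z $ 1 powr - \<gamma> - a)
        + 1 / (2 * \<mu>0 * Z $ 1) * ((B + I * Z $ 2)\<^sup>2 - (Z $ 1)\<^sup>2 * B\<^sup>2)) / \<tau>"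
  "tw_field a \<gamma> \<mu>0 I B \<mu> \<tau> Z $ 2 =
     (Z $ 1 * Z $ 2 - I / \<mu>0 * (B * (1 - Z $ 1) + I * Z $ 2)) / \<mu>"
  by (simp_all add: tw_field_def Let_def pressure_def)

lemma has_derivative_vec2:
  fixes f :: "'a::euclidean_space \<Rightarrow> real^2"
  assumes "((\<lambda>x. f x $ 1) has_derivative (\<lambda>h. f' h $ 1)) (at x within S)"
    and "((\<lambda>x. f x $ 2) has_derivative (\<lambda>h. f' h $ 2)) (at x within S)"
  shows "(f has_derivative f') (at x within S)"
  unfolding has_derivative_componentwise_within[of f]
  using assms by (auto simp: Basis_vec_def inner_axis UNIV_2)

lemma tw_field_has_derivative:
  fixes Z :: "real^2" and \<mu>0 \<tau> \<mu> a \<gamma> I B :: real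
  defines "v \<equiv> Z $ 1" and "w \<equiv> Z $ 2"
  assumes v: "0 < v" and nz: "\<mu>0 \<noteq> 0" "\<tau> \<noteq> 0" "\<mu> \<noteq> 0"
  shows "(tw_field a \<gamma> \<mu>0 I B \<mu> \<tau> has_derivative
    (\<lambda>h. vector [vector [(2 * v - 1 + a * v powr - \<gamma> - a - a * \<gamma> * v powr - \<gamma>
                           - (B + I * w)\<^sup>2 / (2 * \<mu>0 * v\<^sup>2) - B\<^sup>2 / (2 * \<mu>0)) / \<tau>,
                         I * (B + I * w) / (\<mu>0 * v) / \<tau>],
                 vector [(w + I * B / \<mu>0) / \<mu>, (v - I\<^sup>2 / \<mu>0) / \<mu>]] *v h)) (at Z)"
    (is "(_ has_derivative (\<lambda>h. ?M *v h)) _")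
proof (rule has_derivative_vec2)
  have d: "((\<lambda>X :: real^2. X $ i) has_derivative (\<lambda>h. h $ i)) (at Z)" for i
    by (rule bounded_linear_imp_has_derivative[OF bounded_linear_vec_nth])
  have v': "0 < Z $ 1" using v by (simp add: v_def)
  show "((\<lambda>X. tw_field a \<gamma> \<mu>0 I B \<mu> \<tau> X $ 1) has_derivative (\<lambda>h. (?M *v h) $ 1)) (at Z)"
    unfolding tw_field_components
    by (rule derivative_eq_intros d refl | use v' nz in force)+
      (use v' nz in \<open>simp add: fun_eq_iff matrix_vector_mult_def sum_2 v_def w_def powr_diff
        power2_eq_square field_simps\<close>)
  show "((\<lambda>X. tw_field a \<gamma> \<mu>0 I B \<mu> \<tau> X $ 2) has_derivative (\<lambda>h. (?M *v h) $ 2)) (at Z)"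
    unfolding tw_field_components
    by (rule derivative_eq_intros d refl | use nz in force)+
      (use nz in \<open>simp add: fun_eq_iff matrix_vector_mult_def sum_2 v_def w_def
        power2_eq_square field_simps\<close>)
qed

lemma strictly_convex_two_zeros:
  fixes f f' :: "real \<Rightarrow> real"
  assumes \<alpha>\<beta>: "\<alpha> < \<beta>" and zeros: "f \<alpha> = 0" "f \<beta> = 0"
    and f: "\<And>v. v \<in> {\<alpha>..\<beta>} \<Longrightarrow> (f has_real_derivative f' v) (at v)"
    and mono: "strict_mono_on {\<alpha>..\<beta>} f'"
  shows "f' \<alpha> < 0" and "0 < f' \<beta>" and "\<And>v. v \<in> {\<alpha><..<\<beta>} \<Longrightarrow> f v < 0"
proof -
  have mvt: "\<exists>z. u < z \<and> z < w \<and> f w - f u = (w - u) * f' z"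
    if "\<alpha> \<le> u" "u < w" "w \<le> \<beta>" for u w
    using MVT2[of u w f f'] f that by auto
  have less: "f' u < f' w" if "\<alpha> \<le> u" "u < w" "w \<le> \<beta>" for u w
    using strict_mono_onD[OF mono] that by auto
  obtain z where z: "\<alpha> < z" "z < \<beta>" "f' z = 0" using mvt[of \<alpha> \<beta>] \<alpha>\<beta> zeros by auto
  show "f' \<alpha> < 0" "0 < f' \<beta>" using less[of \<alpha> z] less[of z \<beta>] z by auto
  fix v assume v: "v \<in> {\<alpha><..<\<beta>}"
  obtain z1 where z1: "\<alpha> < z1" "z1 < v" "f v = (v - \<alpha>) * f' z1" using mvt[of \<alpha> v] v zeros by auto
  obtain z2 where z2: "v < z2" "z2 < \<beta>" "- f v = (\<beta> - v) * f' z2" using mvt[of v \<beta>] v zeros by auto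
  show "f v < 0"
  proof (rule ccontr)
    assume "\<not> f v < 0"
    then have "0 \<le> (v - \<alpha>) * f' z1" "0 \<le> (\<beta> - v) * (- f' z2)"
      using z1(3) z2(3) by simp_all
    then have "0 \<le> f' z1" "f' z2 \<le> 0"
      using v by (auto simp: zero_le_mult_iff mult_le_0_iff)
    then show False using less[of z1 z2] z1 z2 by auto
  qed
qed

text \<open>
  The first component of the field divided by \<open>v / \<tau>\<close> and restricted to the nullcline of \<open>w\<close>, for \<open>p\<^sub>- = a\<close>.
  Its zeros are the \<open>v\<close>-coordinates of the rest points.
\<close>
definition rest_balance :: "real \<Rightarrow> real \<Rightarrow> real \<Rightarrow> real \<Rightarrow> real \<Rightarrow> real" where
  "rest_balance a \<gamma> J K v = v - 1 + a * v powr - \<gamma> - a - J + J * (1 - K)\<^sup>2 / (v - K)\<^sup>2"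

definition rest_balance_slope :: "real \<Rightarrow> real \<Rightarrow> real \<Rightarrow> real \<Rightarrow> real \<Rightarrow> real" where
  "rest_balance_slope a \<gamma> J K v =
     1 - a * \<gamma> * v powr (- \<gamma> - 1) - 2 * J * (1 - K)\<^sup>2 / (v - K) ^ 3"

lemma rest_balance_has_derivative:
  assumes "0 < v" "v \<noteq> K"
  shows "(rest_balance a \<gamma> J K has_real_derivative rest_balance_slope a \<gamma> J K v) (at v)"
proof -
  have "((\<lambda>x. c / x\<^sup>2) has_real_derivative - 2 * c / u ^ 3) (at u)" if "u \<noteq> 0" for c u :: real
    using that by (auto intro!: derivative_eq_intros simp: field_simps power2_eq_square power3_eq_cube)
  then have 1: "((\<lambda>x. c / x\<^sup>2) has_real_derivative - 2 * c / (v - K) ^ 3) (at (v - K))" for c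
    using assms(2) by simp
  have 2: "((\<lambda>v. v - K) has_real_derivative 1) (at v)"
    by (auto intro!: derivative_eq_intros)
  have inv: "((\<lambda>v. c / (v - K)\<^sup>2) has_real_derivative - 2 * c / (v - K) ^ 3) (at v)" for c
    using DERIV_chain2[where f = "\<lambda>x. c / x\<^sup>2" and g = "\<lambda>v. v - K", OF 1 2] by simp
  have "((\<lambda>v. v - 1 + a * v powr - \<gamma> - a - J) has_real_derivative
      1 - a * \<gamma> * v powr (- \<gamma> - 1)) (at v)"
    using assms(1) by (auto intro!: derivative_eq_intros)
  from DERIV_add[OF this inv[of "J * (1 - K)\<^sup>2"]] show ?thesis
    unfolding rest_balance_def[abs_def] rest_balance_slope_def by (simp add: mult.assoc)
qed

text \<open>
  The interval must avoid \<open>K\<close>: from the left the slope tends to \<open>\<infinity>\<close> at this pole, and to its right it starts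
  again from \<open>- \<infinity>\<close>.
\<close>
lemma rest_balance_slope_strict_mono:
  assumes "0 < a" "1 \<le> \<gamma>" "0 < J" "K \<noteq> 1" "0 < \<alpha>" and side: "\<beta> < K \<or> K < \<alpha>"
  shows "strict_mono_on {\<alpha>..\<beta>} (rest_balance_slope a \<gamma> J K)"
proof (rule strict_mono_onI)
  fix u w assume uw: "u \<in> {\<alpha>..\<beta>}" "w \<in> {\<alpha>..\<beta>}" "u < w"
  have "w powr (- \<gamma> - 1) < u powr (- \<gamma> - 1)"
    using assms uw by (intro powr_less_mono2_neg) auto
  then have 1: "a * \<gamma> * w powr (- \<gamma> - 1) < a * \<gamma> * u powr (- \<gamma> - 1)"
    using assms by simp
  have "1 / (w - K) ^ 3 < 1 / (u - K) ^ 3"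
    using side
  proof
    assume "K < \<alpha>"
    then show ?thesis using uw
      by (intro divide_strict_left_mono power_strict_mono mult_pos_pos zero_less_power) auto
  next
    assume "\<beta> < K"
    then have "1 / (K - u) ^ 3 < 1 / (K - w) ^ 3" using uw
      by (intro divide_strict_left_mono power_strict_mono mult_pos_pos zero_less_power) auto
    moreover have "(t - K) ^ 3 = - ((K - t) ^ 3)" for t
      by (simp add: power3_eq_cube algebra_simps)
    ultimately show ?thesis by simp
  qed
  then have "2 * J * (1 - K)\<^sup>2 * (1 / (w - K) ^ 3) < 2 * J * (1 - K)\<^sup>2 * (1 / (u - K) ^ 3)"
    using assms by (intro mult_strict_left_mono) auto
  then show "rest_balance_slope a \<gamma> J K u < rest_balance_slope a \<gamma> J K w"
    using 1 by (simp add: rest_balance_slope_def)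
qed

text \<open>
  The fourth relation states that at a rest point the off-diagonal entries of the linearization agree up to the
  factors \<open>\<tau>\<close> and \<open>\<mu>\<close>. Away from the nullcline of \<open>w\<close> they differ.
\<close>
lemma rest_point_tw_fieldD:
  fixes Z :: "real^2" and a \<gamma> \<mu>0 I B \<mu> \<tau> J K :: real
  defines "v \<equiv> Z $ 1" and "w \<equiv> Z $ 2"
  assumes pos: "0 < \<mu>0" "0 < \<mu>" "0 < \<tau>"
    and J: "J = B\<^sup>2 / (2 * \<mu>0)" and K: "K = I\<^sup>2 / \<mu>0"
    and rest: "rest_point phase_space (tw_field a \<gamma> \<mu>0 I B \<mu> \<tau>) Z"
    and vK: "v \<noteq> K"
  shows "0 < v" and "v * w = I / \<mu>0 * (B * (1 - v) + I * w)"
    and "B + I * w = B * (1 - K) * v / (v - K)"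
    and "w + I * B / \<mu>0 = I * (B + I * w) / (\<mu>0 * v)"
    and "rest_balance a \<gamma> J K v = 0"
proof -
  show v: "0 < v" using rest by (simp add: rest_point_def phase_space_def v_def)
  have "tw_field a \<gamma> \<mu>0 I B \<mu> \<tau> Z $ 1 = 0" "tw_field a \<gamma> \<mu>0 I B \<mu> \<tau> Z $ 2 = 0"
    using rest by (simp_all add: rest_point_def)
  then have f: "v * (v - 1) + v * (a * v powr - \<gamma> - a) + 1 / (2 * \<mu>0 * v) * ((B + I * w)\<^sup>2 - v\<^sup>2 * B\<^sup>2) = 0"
    and g: "v * w = I / \<mu>0 * (B * (1 - v) + I * w)"
    using pos by (auto simp: tw_field_components v_def w_def)
  show "v * w = I / \<mu>0 * (B * (1 - v) + I * w)" by (rule g)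
  have "I * (v * w) = K * (B * (1 - v) + I * w)"
    unfolding g K by (simp add: power2_eq_square)
  then have "(B + I * w) * (v - K) = B * (1 - K) * v"
    by (simp add: algebra_simps)
  then show b: "B + I * w = B * (1 - K) * v / (v - K)"
    using vK by (simp add: eq_divide_eq)
  have "v * (w + I * B / \<mu>0) = I * (B + I * w) / \<mu>0"
    using g by (simp add: algebra_simps add_divide_distrib)
  then show "w + I * B / \<mu>0 = I * (B + I * w) / (\<mu>0 * v)"
    using v pos by (simp add: field_simps)
  have "1 / (2 * \<mu>0 * v) * ((B + I * w)\<^sup>2 - v\<^sup>2 * B\<^sup>2) = v * (J * (1 - K)\<^sup>2 / (v - K)\<^sup>2 - J)"
  proof -
    define x where "x = (1 - K) / (v - K)"
    have "B + I * w = B * x * v" "J * (1 - K)\<^sup>2 / (v - K)\<^sup>2 = J * x\<^sup>2"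
      by (simp_all add: b x_def power_divide)
    then show ?thesis
      unfolding J using v pos by (simp add: field_simps power2_eq_square)
  qed
  then have "v * rest_balance a \<gamma> J K v = 0"
    using f by (simp add: rest_balance_def algebra_simps)
  then show "rest_balance a \<gamma> J K v = 0" using v by simp
qed

text \<open>
  Up to the factors \<open>1 / \<tau>\<close> and \<open>1 / \<mu>\<close> of its rows the matrix is symmetric, whence \<open>q r \<ge> 0\<close>. Differentiating
  the first component along the nullcline of \<open>w\<close> shows that the determinant is a positive multiple of
  \<open>(v - K)\<close> times the slope of \<open>rest_balance\<close>.
\<close>
lemma rest_point_linearization:
  fixes Z :: "real^2" and a \<gamma> \<mu>0 I B \<mu> \<tau> J K :: real
  defines "v \<equiv> Z $ 1"
  assumes pos: "0 < \<mu>0" "0 < \<mu>" "0 < \<tau>"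
    and J: "J = B\<^sup>2 / (2 * \<mu>0)" and K: "K = I\<^sup>2 / \<mu>0"
    and rest: "rest_point phase_space (tw_field a \<gamma> \<mu>0 I B \<mu> \<tau>) Z"
    and vK: "v \<noteq> K"
  obtains p q r where
    "(tw_field a \<gamma> \<mu>0 I B \<mu> \<tau> has_derivative
      (\<lambda>h. vector [vector [p, q], vector [r, (v - K) / \<mu>]] *v h)) (at Z)"
    and "0 \<le> q * r"
    and "p * ((v - K) / \<mu>) - q * r = (v - K) * v * rest_balance_slope a \<gamma> J K v / (\<tau> * \<mu>)"
proof -
  define w where "w = Z $ 2"
  define b where "b = B + I * w"
  define p where "p = 2 * v - 1 + a * v powr - \<gamma> - a - a * \<gamma> * v powr - \<gamma>
    - b\<^sup>2 / (2 * \<mu>0 * v\<^sup>2) - B\<^sup>2 / (2 * \<mu>0)"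
  define e where "e = I * b / (\<mu>0 * v)"
  note rest' = rest_point_tw_fieldD[OF pos J K rest vK[unfolded v_def], folded v_def w_def b_def e_def]
  have v: "0 < v" by (rule rest')
  have b2: "b\<^sup>2 / (2 * \<mu>0) = J * (1 - K)\<^sup>2 * v\<^sup>2 / (v - K)\<^sup>2"
    unfolding rest'(3) J using pos by (simp add: power_divide power_mult_distrib)
  have b2': "b\<^sup>2 / (2 * \<mu>0 * v\<^sup>2) = J * (1 - K)\<^sup>2 / (v - K)\<^sup>2"
    using b2 v pos by (simp add: field_simps)
  have "e\<^sup>2 = 2 * K * (b\<^sup>2 / (2 * \<mu>0 * v\<^sup>2))"
    unfolding e_def K using v pos by (simp add: field_simps power2_eq_square)
  then have e2: "e\<^sup>2 = 2 * K * (J * (1 - K)\<^sup>2 / (v - K)\<^sup>2)"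
    unfolding b2' .
  have powr: "v powr (- \<gamma>) = v * v powr (- \<gamma> - 1)"
    using v by (simp add: powr_diff)
  define X where "X = J * (1 - K)\<^sup>2 / (v - K)\<^sup>2"
  have p: "p = v * (1 - a * \<gamma> * v powr (- \<gamma> - 1)) - 2 * X"
    using rest'(5) powr unfolding p_def b2' rest_balance_def J X_def[unfolded J, symmetric]
    by (simp add: algebra_simps)
  have "(v - K) * p - e\<^sup>2 = (v - K) * (v * (1 - a * \<gamma> * v powr (- \<gamma> - 1))) - 2 * v * X"
    unfolding e2[folded X_def] p by (simp add: algebra_simps)
  also have "2 * v * X = (v - K) * v * (2 * J * (1 - K)\<^sup>2 / (v - K) ^ 3)"
  proof -
    have "2 * v * (j * c / t\<^sup>2) = t * v * (2 * j * c / t ^ 3)" if "t \<noteq> 0" for t j c :: real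
      using that by (simp add: power2_eq_square power3_eq_cube)
    then show ?thesis
      using vK unfolding X_def by simp
  qed
  also have "(v - K) * (v * (1 - a * \<gamma> * v powr (- \<gamma> - 1))) - \<dots> = (v - K) * v * rest_balance_slope a \<gamma> J K v"
    unfolding rest_balance_slope_def by (simp only: right_diff_distrib mult.assoc)
  finally have det: "(v - K) * p - e\<^sup>2 = (v - K) * v * rest_balance_slope a \<gamma> J K v" .
  show thesis
  proof (rule that[of "p / \<tau>" "e / \<tau>" "e / \<mu>"])
    show "(tw_field a \<gamma> \<mu>0 I B \<mu> \<tau> has_derivative
      (\<lambda>h. vector [vector [p / \<tau>, e / \<tau>], vector [e / \<mu>, (v - K) / \<mu>]] *v h)) (at Z)"
      using tw_field_has_derivative[of Z \<mu>0 \<tau> \<mu> a \<gamma> I B, folded v_def w_def b_def K] v pos rest'(4)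
      by (simp add: p_def e_def)
    show "0 \<le> e / \<tau> * (e / \<mu>)" using pos by simp
    have "p / \<tau> * ((v - K) / \<mu>) - e / \<tau> * (e / \<mu>) = ((v - K) * p - e\<^sup>2) / (\<tau> * \<mu>)"
      by (simp add: power2_eq_square mult.commute flip: diff_divide_distrib)
    then show "p / \<tau> * ((v - K) / \<mu>) - e / \<tau> * (e / \<mu>)
      = (v - K) * v * rest_balance_slope a \<gamma> J K v / (\<tau> * \<mu>)"
      by (simp only: det)
  qed
qed

lemma rest_point_type:
  fixes Z :: "real^2" and a \<gamma> \<mu>0 I B \<mu> \<tau> J K :: real
  defines "v \<equiv> Z $ 1" and "F \<equiv> tw_field a \<gamma> \<mu>0 I B \<mu> \<tau>"
  assumes pos: "0 < \<mu>0" "0 < \<mu>" "0 < \<tau>"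
    and J: "J = B\<^sup>2 / (2 * \<mu>0)" and K: "K = I\<^sup>2 / \<mu>0"
    and rest: "rest_point phase_space F Z"
    and vK: "v \<noteq> K"
  shows "K < v \<Longrightarrow> 0 < rest_balance_slope a \<gamma> J K v \<Longrightarrow> repelling_node F Z"
    and "v < K \<Longrightarrow> rest_balance_slope a \<gamma> J K v < 0 \<Longrightarrow> attracting_node F Z"
    and "(v - K) * rest_balance_slope a \<gamma> J K v < 0 \<Longrightarrow> saddle F Z"
proof -
  obtain p q r where der: "(F has_derivative
      (\<lambda>h. vector [vector [p, q], vector [r, (v - K) / \<mu>]] *v h)) (at Z)"
    and qr: "0 \<le> q * r"
    and det: "p * ((v - K) / \<mu>) - q * r = (v - K) * v * rest_balance_slope a \<gamma> J K v / (\<tau> * \<mu>)"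
    using rest_point_linearization[OF pos J K rest[unfolded F_def] vK[unfolded v_def]]
    unfolding v_def F_def by blast
  have zero: "F Z = 0" and v: "0 < v"
    using rest by (auto simp: rest_point_def phase_space_def v_def)
  show "repelling_node F Z" if "K < v" "0 < rest_balance_slope a \<gamma> J K v"
  proof -
    have "0 < (v - K) * v * rest_balance_slope a \<gamma> J K v / (\<tau> * \<mu>)" "0 < (v - K) / \<mu>"
      using that pos v by auto
    then have "\<forall>l. eigenvalue_of (vector [vector [p, q], vector [r, (v - K) / \<mu>]]) l \<longrightarrow> l \<in> \<real> \<and> 0 < Re l"
      using eigenvalues_positive[OF qr, of p "(v - K) / \<mu>"] det by auto
    then show ?thesis using zero der unfolding repelling_node_def by blast
  qed
  show "attracting_node F Z" if "v < K" "rest_balance_slope a \<gamma> J K v < 0"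
  proof -
    have "0 < (v - K) * v * rest_balance_slope a \<gamma> J K v / (\<tau> * \<mu>)" "(v - K) / \<mu> < 0"
      using that pos v by (auto simp: zero_less_mult_iff mult_less_0_iff divide_less_0_iff)
    then have "\<forall>l. eigenvalue_of (vector [vector [p, q], vector [r, (v - K) / \<mu>]]) l \<longrightarrow> l \<in> \<real> \<and> Re l < 0"
      using eigenvalues_negative[OF qr, of p "(v - K) / \<mu>"] det by auto
    then show ?thesis using zero der unfolding attracting_node_def by blast
  qed
  show "saddle F Z" if "(v - K) * rest_balance_slope a \<gamma> J K v < 0"
  proof -
    have "(v - K) * rest_balance_slope a \<gamma> J K v * (v / (\<tau> * \<mu>)) < 0"
      using pos v by (intro mult_neg_pos[OF that]) simp
    then have "p * ((v - K) / \<mu>) < q * r" using det by (simp add: mult_ac)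
    from eigenvalues_opposite[OF this] show ?thesis
      using zero der unfolding saddle_def by blast
  qed
qed

section \<open>Existence of monotone Lax profiles\<close>

theorem proposition4p2:
  fixes a \<gamma> \<mu>0 I B \<mu> \<eta> \<tau> J K :: real
    and Zi Zj :: "real^2"
  assumes "1 \<le> \<gamma>" and "0 < a"
    and "0 < \<mu>0" and "0 \<le> I" and "0 < \<mu>"
    and "\<tau> = 2 * \<mu> + \<eta>" and "0 < \<tau>"
    and "J = B\<^sup>2 / (2 * \<mu>0)" and "0 < J"
    and "K = I\<^sup>2 / \<mu>0" and "0 \<le> K" and "K \<noteq> 1"
    and "rest_point phase_space (tw_field a \<gamma> \<mu>0 I B \<mu> \<tau>) Zi"
    and "rest_point phase_space (tw_field a \<gamma> \<mu>0 I B \<mu> \<tau>) Zj"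
    and "Zi $ 1 < Zj $ 1"
    and "(Zi $ 1 < K \<and> Zj $ 1 < K) \<or> (K < Zi $ 1 \<and> K < Zj $ 1)"
  shows "\<exists>Z. lax_viscous_profile (tw_field a \<gamma> \<mu>0 I B \<mu> \<tau>) Zj Zi Z \<and>
             (mono (\<lambda>x. Z x $ 1) \<or> antimono (\<lambda>x. Z x $ 1)) \<and>
             (mono (\<lambda>x. Z x $ 2) \<or> antimono (\<lambda>x. Z x $ 2))"
proof -
  let ?F = "tw_field a \<gamma> \<mu>0 I B \<mu> \<tau>"
  define \<alpha> where "\<alpha> = Zi $ 1"
  define \<beta> where "\<beta> = Zj $ 1"
  note pos = \<open>0 < \<mu>0\<close> \<open>0 < \<mu>\<close> \<open>0 < \<tau>\<close> and J = \<open>J = B\<^sup>2 / (2 * \<mu>0)\<close> and K = \<open>K = I\<^sup>2 / \<mu>0\<close>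
  have side: "\<beta> < K \<or> K < \<alpha>" and \<alpha>\<beta>: "\<alpha> < \<beta>" and ends: "\<alpha> \<noteq> K" "\<beta> \<noteq> K"
    using assms by (auto simp: \<alpha>_def \<beta>_def)
  note rest_i = rest_point_tw_fieldD[OF pos J K assms(13) ends(1)[unfolded \<alpha>_def], folded \<alpha>_def]
  note rest_j = rest_point_tw_fieldD[OF pos J K assms(14) ends(2)[unfolded \<beta>_def], folded \<beta>_def]
  have \<alpha>: "0 < \<alpha>" by (rule rest_i)
  have inside: "0 < v" "v \<noteq> K" if "v \<in> {\<alpha>..\<beta>}" for v
    using that \<alpha> side by auto
  have B: "B \<noteq> 0" using J assms(9) by auto

  let ?\<phi> = "rest_balance a \<gamma> J K" and ?\<phi>' = "rest_balance_slope a \<gamma> J K"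
  have slopes: "?\<phi>' \<alpha> < 0" "0 < ?\<phi>' \<beta>" and between: "\<And>v. v \<in> {\<alpha><..<\<beta>} \<Longrightarrow> ?\<phi> v < 0"
    using strictly_convex_two_zeros[OF \<alpha>\<beta> rest_i(5) rest_j(5) rest_balance_has_derivative[OF inside]
        rest_balance_slope_strict_mono[OF assms(2,1,9,12) \<alpha> side]] by blast+

  have lax: "lax_connection ?F Zj Zi"
    using side
  proof
    assume "K < \<alpha>"
    then show ?thesis
      using rest_point_type(3)[OF pos J K assms(13)] rest_point_type(1)[OF pos J K assms(14)] slopes \<alpha>\<beta>
      unfolding lax_connection_def by (fold \<alpha>_def \<beta>_def) (simp add: mult_pos_neg)
  next
    assume "\<beta> < K"
    then show ?thesis
      using rest_point_type(2)[OF pos J K assms(13)] rest_point_type(3)[OF pos J K assms(14)] slopes \<alpha>\<beta>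
      unfolding lax_connection_def by (fold \<alpha>_def \<beta>_def) (simp add: mult_neg_pos)
  qed

  \<comment> \<open>\<open>s\<close> is the sign of \<open>(1 - K) / (v - K)\<close>, i.e. of \<open>(B + I w) / B\<close> at the rest points.\<close>
  define \<sigma> :: real where "\<sigma> = (if K < \<alpha> then 1 else - 1)"
  define s where "s = \<sigma> * sgn (1 - K)"
  define d where "d = \<bar>1 - K\<bar>"
  have \<sigma>: "\<sigma> = 1 \<or> \<sigma> = - 1" by (simp add: \<sigma>_def)
  have \<sigma>_pos: "0 < \<sigma> * (v - K)" if "v \<in> {\<alpha>..\<beta>}" for v
    using that side by (auto simp: \<sigma>_def)
  have d: "0 < d" "s * \<sigma> * d = 1 - K" and s: "s * s = 1"
    using \<sigma> assms(12) by (auto simp: s_def d_def sgn_if)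
  have d2: "d\<^sup>2 = (1 - K)\<^sup>2" by (simp add: d_def)

  \<comment> \<open>The coefficients of the planar system for \<open>v\<close> and \<open>y = s (B + I w) / B\<close>.\<close>
  define q where "q v = v - 1 + a * v powr - \<gamma> - a - J" for v
  define q' where "q' v = 1 - a * \<gamma> * v powr (- \<gamma> - 1)" for v
  define A where "A v = - (v\<^sup>2 * q v) / J" for v
  define A' where "A' v = - (2 * v * q v + v\<^sup>2 * q' v) / J" for v
  define Y where "Y v = \<sigma> * d * v / (v - K)" for v
  define Y' where "Y' v = - (\<sigma> * d * K / (v - K)\<^sup>2)" for v
  define k where "k v = J / (\<tau> * v)" for v
  define n where "n v = \<sigma> * (v - K) / \<mu>" for v
  have A_Y: "A v - (Y v)\<^sup>2 = - (v\<^sup>2 * ?\<phi> v / J)" if "v \<in> {\<alpha>..\<beta>}" for v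
  proof -
    have "\<sigma>\<^sup>2 = 1" using \<sigma> by auto
    then have "(Y v)\<^sup>2 = v\<^sup>2 * ((1 - K)\<^sup>2 / (v - K)\<^sup>2)"
      by (simp add: Y_def power_mult_distrib power_divide d2)
    then show ?thesis
      using assms(9) by (simp add: A_def q_def rest_balance_def field_simps)
  qed
  have q_der: "(q has_real_derivative q' v) (at v)" if "v \<in> {\<alpha>..\<beta>}" for v
    unfolding q_def[abs_def] q'_def using inside(1)[OF that] by (auto intro!: derivative_eq_intros)
  have cont_powr: "continuous_on {\<alpha>..\<beta>} (\<lambda>v. v powr r)" for r :: real
    using \<alpha> by (intro continuous_intros) auto
  obtain V E where V: "\<And>x. V x \<in> {\<alpha><..<\<beta>}" and YE: "\<And>x. Y (V x) \<le> E x"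
    and V': "\<And>x. (V has_real_derivative - (k (V x) * (A (V x) - (E x)\<^sup>2))) (at x)"
    and E': "\<And>x. (E has_real_derivative \<sigma> * (n (V x) * (E x - Y (V x)))) (at x)"
    and V_lim: "(V \<longlongrightarrow> \<beta>) at_bot" "(V \<longlongrightarrow> \<alpha>) at_top"
    and E_lim: "(E \<longlongrightarrow> Y \<beta>) at_bot" "(E \<longlongrightarrow> Y \<alpha>) at_top"
    and V_mono: "antimono V" and E_mono: "mono (\<lambda>x. \<sigma> * E x)"
  proof (rule planar_profile_between_nullclines[OF \<sigma> \<alpha>\<beta>, of A A' Y Y' k n])
    fix v assume v: "v \<in> {\<alpha>..\<beta>}"
    note v' = inside[OF v]
    show "(A has_real_derivative A' v) (at v)"
      unfolding A_def[abs_def] A'_def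
      by (rule DERIV_cdivide) (auto intro!: derivative_eq_intros q_der[OF v])
    show "(Y has_real_derivative Y' v) (at v)"
    proof -
      have "(Y has_real_derivative (\<sigma> * d * (v - K) - \<sigma> * d * v) / ((v - K) * (v - K))) (at v)"
        unfolding Y_def[abs_def] using v' by (auto intro!: derivative_eq_intros)
      also have "(\<sigma> * d * (v - K) - \<sigma> * d * v) / ((v - K) * (v - K)) = Y' v"
        by (simp add: Y'_def power2_eq_square algebra_simps)
      finally show ?thesis .
    qed
    show "0 < k v" using v' pos assms(9) by (simp add: k_def)
    show "0 < n v" using \<sigma>_pos[OF v] pos by (simp add: n_def)
    have "Y v = d * v / (\<sigma> * (v - K))"
      using \<sigma> v'(2) by (auto simp: Y_def divide_simps)
    then show "0 < Y v" using \<sigma>_pos[OF v] v' d(1) by simp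
    have "\<sigma> * Y' v = - (d * K / (v - K)\<^sup>2)"
      using \<sigma> by (auto simp: Y'_def)
    then show "\<sigma> * Y' v \<le> 0" using d(1) assms(11) by simp
  next
    show "continuous_on {\<alpha>..\<beta>} A'" "continuous_on {\<alpha>..\<beta>} Y'" "continuous_on {\<alpha>..\<beta>} k" "continuous_on {\<alpha>..\<beta>} n"
      unfolding A'_def Y'_def k_def n_def q_def q'_def
      using inside \<alpha> pos assms(9) by (auto intro!: continuous_intros cont_powr)
  next
    fix v assume v: "v \<in> {\<alpha><..<\<beta>}"
    have "0 < - (v\<^sup>2 * ?\<phi> v / J)"
      using between[OF v] inside(1)[of v] v assms(9) by (simp add: divide_less_0_iff mult_pos_neg)
    then show "(Y v)\<^sup>2 < A v" using A_Y[of v] v by simp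
  next
    show "A \<alpha> = (Y \<alpha>)\<^sup>2" "A \<beta> = (Y \<beta>)\<^sup>2"
      using A_Y[of \<alpha>] A_Y[of \<beta>] \<alpha>\<beta> rest_i(5) rest_j(5) by auto
  qed (rule that | assumption)+

  \<comment> \<open>For \<open>I = 0\<close> the variable \<open>y\<close> does not determine \<open>w\<close>; then \<open>w = 0\<close> at rest and \<open>y\<close> must be constantly 1.\<close>
  define w where "w x = (if I = 0 then 0 else B * (s * E x - 1) / I)" for x
  have BIw: "B + I * w x = s * B * E x" for x
  proof (cases "I = 0")
    case True
    then have "K = 0" "\<sigma> = 1" "d = 1" "s = 1"
      using K \<alpha> by (auto simp: \<sigma>_def d_def s_def)
    then have Y1: "Y v = 1" if "v \<in> {\<alpha>..\<beta>}" for v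
      using inside[OF that] by (simp add: Y_def)
    \<comment> \<open>Now \<open>Y = 1\<close>, and \<open>E\<close> is nondecreasing, at least 1 and tends to 1.\<close>
    have "1 \<le> E x" using YE[of x] Y1[of "V x"] V[of x] by simp
    moreover have "E x \<le> 1"
    proof (rule tendsto_lowerbound)
      show "(E \<longlongrightarrow> 1) at_top" using E_lim(2) Y1[of \<alpha>] \<alpha>\<beta> by simp
      show "\<forall>\<^sub>F z in at_top. E x \<le> E z"
        using eventually_ge_at_top[of x] by eventually_elim (use E_mono \<open>\<sigma> = 1\<close> in \<open>auto simp: mono_def\<close>)
    qed simp
    ultimately show ?thesis using True \<open>s = 1\<close> by simp
  next
    case False
    then have "I * w x = B * (s * E x - 1)" by (simp add: w_def)
    then show ?thesis by (simp add: algebra_simps)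
  qed
  have w': "(w has_real_derivative (V x * w x - I / \<mu>0 * (B * (1 - V x) + I * w x)) / \<mu>) (at x)" for x
  proof (cases "I = 0")
    case True
    then show ?thesis by (simp add: w_def[abs_def])
  next
    case False
    have vK: "V x - K \<noteq> 0" using inside(2)[of "V x"] V[of x] by auto
    have "(V x - K) * Y (V x) = \<sigma> * d * V x"
      using vK by (simp add: Y_def)
    moreover have "\<sigma> * (\<sigma> * t / \<mu> * (e - y)) = (t * e - t * y) / \<mu>" for t e y
      using \<sigma> by (auto simp: right_diff_distrib diff_divide_distrib)
    ultimately have "\<sigma> * (n (V x) * (E x - Y (V x))) = ((V x - K) * E x - \<sigma> * d * V x) / \<mu>"
      by (simp only: n_def)
    then have "B * s / I * (\<sigma> * (n (V x) * (E x - Y (V x))))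
        = B / I * (s * ((V x - K) * E x - \<sigma> * d * V x)) / \<mu>"
      by simp
    also have "s * ((V x - K) * E x - \<sigma> * d * V x) = (V x - K) * (s * E x) - s * \<sigma> * d * V x"
      by (simp add: algebra_simps)
    also have "\<dots> = V x * (s * E x - 1) - K * (s * E x - V x)"
      unfolding d(2) by (simp add: algebra_simps)
    also have "B / I * \<dots> = V x * w x - I / \<mu>0 * (B * (1 - V x) + I * w x)"
    proof -
      have 1: "I / \<mu>0 = K / I" "V x * w x = B / I * (V x * (s * E x - 1))"
        using False K pos by (simp_all add: power2_eq_square w_def)
      have 2: "B * (1 - V x) + I * w x = B * (s * E x - V x)"
        using BIw[of x] by (simp add: algebra_simps)
      show ?thesis
        unfolding 1 2 right_diff_distrib[of "B / I" "V x * (s * E x - 1)"] by simp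
    qed
    finally have "B * s / I * (\<sigma> * (n (V x) * (E x - Y (V x))))
      = (V x * w x - I / \<mu>0 * (B * (1 - V x) + I * w x)) / \<mu>" .
    moreover have "(w has_real_derivative B * s / I * (\<sigma> * (n (V x) * (E x - Y (V x))))) (at x)"
      unfolding w_def[abs_def] using False by (auto intro!: derivative_eq_intros E')
    ultimately show ?thesis by simp
  qed
  have w_lim: "(w \<longlongrightarrow> Z $ 2) G"
    if "(E \<longlongrightarrow> Y (Z $ 1)) G" "B + I * Z $ 2 = B * (1 - K) * Z $ 1 / (Z $ 1 - K)"
      and "Z $ 1 * Z $ 2 = I / \<mu>0 * (B * (1 - Z $ 1) + I * Z $ 2)" "Z $ 1 \<noteq> 0"
    for Z :: "real^2" and G
  proof (cases "I = 0")
    case True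
    then have "Z $ 2 = 0" using that(3,4) by simp
    then show ?thesis using True by (simp add: w_def[abs_def])
  next
    case False
    have "B + I * Z $ 2 = B * (s * Y (Z $ 1))"
      unfolding that(2) Y_def d(2)[symmetric] by simp
    then have "Z $ 2 = B * (s * Y (Z $ 1) - 1) / I"
      using False by (simp add: field_simps)
    then show ?thesis
      unfolding w_def[abs_def] using False by (auto intro!: tendsto_intros that(1))
  qed
  define Z :: "real \<Rightarrow> real^2" where "Z x = vector [V x, w x]" for x
  have Z: "Z x $ 1 = V x" "Z x $ 2 = w x" for x by (simp_all add: Z_def)
  have Z': "(Z has_vector_derivative ?F (Z x)) (at x)" for x
  proof -
    have "V x > 0" using inside(1)[of "V x"] V[of x] by auto
    moreover have "(B + I * w x)\<^sup>2 = B\<^sup>2 * (E x)\<^sup>2"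
      unfolding BIw using s by (simp add: power2_eq_square mult_ac)
    ultimately have "- (k (V x) * (A (V x) - (E x)\<^sup>2)) = ?F (Z x) $ 1"
      unfolding tw_field_components Z k_def A_def q_def J using pos B
      by (simp add: field_simps power2_eq_square)
    then have "(V has_real_derivative ?F (Z x) $ 1) (at x)" using V'[of x] by simp
    moreover have "(w has_real_derivative ?F (Z x) $ 2) (at x)"
      using w'[of x] by (simp add: tw_field_components Z)
    ultimately show ?thesis
      unfolding has_vector_derivative_def
      by (intro has_derivative_vec2) (simp_all add: Z has_field_derivative_def mult_commute_abs)
  qed
  have Z_lim: "(Z \<longlongrightarrow> P) G" if "(V \<longlongrightarrow> P $ 1) G" "(w \<longlongrightarrow> P $ 2) G" for P G
  proof (rule vec_tendstoI)
    show "((\<lambda>x. Z x $ i) \<longlongrightarrow> P $ i) G" for i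
      using that exhaust_2[of i] by (auto simp: Z)
  qed
  have "heteroclinic phase_space ?F Zj Zi Z"
    unfolding heteroclinic_def
  proof (intro conjI allI)
    show "Zj \<noteq> Zi" using assms(15) by auto
    show "Z x \<in> phase_space" for x
      using V[of x] \<alpha> by (auto simp: phase_space_def Z)
    show "(Z \<longlongrightarrow> Zj) at_bot"
      using V_lim(1) E_lim(1) rest_j(1,2,3) unfolding \<beta>_def by (intro Z_lim w_lim) auto
    show "(Z \<longlongrightarrow> Zi) at_top"
      using V_lim(2) E_lim(2) rest_i(1,2,3) unfolding \<alpha>_def by (intro Z_lim w_lim) auto
  qed (use assms Z' in auto)
  then have "lax_viscous_profile ?F Zj Zi Z"
    using lax assms(15) by (simp add: lax_viscous_profile_def viscous_profile_def)
  moreover have "antimono (\<lambda>x. Z x $ 1)" using V_mono by (simp add: Z)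
  moreover have "mono (\<lambda>x. Z x $ 2) \<or> antimono (\<lambda>x. Z x $ 2)"
  proof (cases "I = 0")
    case True
    then show ?thesis by (simp add: Z w_def mono_def)
  next
    case False
    define c where "c = B * s * \<sigma> / I"
    have w_eq: "w x = c * (\<sigma> * E x) - B / I" for x
      using False \<sigma> by (auto simp: w_def c_def diff_divide_distrib algebra_simps)
    show ?thesis
    proof (cases "0 \<le> c")
      case True
      then have "mono w" using E_mono unfolding w_eq[abs_def] mono_def by (auto intro: mult_left_mono)
      then show ?thesis by (simp add: Z)
    next
      case False
      then have "antimono w" using E_mono unfolding w_eq[abs_def] mono_def antimono_def
        by (auto intro!: mult_left_mono_neg)
      then show ?thesis by (simp add: Z)
    qed
  qed
  ultimately show ?thesis by blast
qed

end
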